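(* Let $\mathcal K_{\boldsymbol s}$ be a singular kernel given by the series expansion $$\mathcal K_{\boldsymbol s}=\sum_{\ell=1,2,\dots} R^{-2(\ell+m_1)+1}\,P^{[\ell]}_{3\ell+m_2},$$ with regularity $m:=\zeta(\mathcal K_{\boldsymbol s})=-2m_1+m_2+2<0$, and let $$\mathcal K_{\boldsymbol s,n}=\sum_{\ell=1}^{n} R^{-2(\ell+m_1)+1}\,P^{[\ell]}_{3\ell+m_2}$$ be the approximation of $\mathcal K_{\boldsymbol s}$ obtained by truncating the series after the $n$-th term, with $P^{[1]}_{m_2+3}(\boldsymbol z)\ne 0$ for $\boldsymbol z\in D_\varepsilon$. Let $\rho=\mathcal K_{\boldsymbol s}/\mathcal K_{\boldsymbol s,n}$ be the regularized kernel. Then $\rho$ is a $C^{n-1}$ smooth function at $\boldsymbol z=\boldsymbol 0$ and $D^\alpha\rho(\boldsymbol 0)=0$ for $1\le|\alpha|\le n-1$.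
   Context: The kernel $\mathcal K_{\boldsymbol s}=\mathcal K_{\boldsymbol s}(\boldsymbol z)$ is expressed about a fixed source point $\boldsymbol s$ in local intrinsic coordinates $\boldsymbol z=(z_1,z_2)\in\mathbb R^2$, and the source point corresponds to $\boldsymbol z=\boldsymbol 0$. The numbers $m_1\ge 0$ and $m_2\ge -3$ are integers, and $n$ is a positive integer. The function $R$ is $R(\boldsymbol z)=\sqrt{a z_1^2+b z_1z_2+c z_2^2}$ with real constants $a,c>0$ and $b$ satisfying $4ac-b^2>0$. Each $P^{[\ell]}_{3\ell+m_2}$ is a bivariate homogeneous polynomial of degree $3\ell+m_2$; in particular $P^{[1]}_{m_2+3}$ is the polynomial of the first term. The parameter $\zeta$ is defined by $\zeta(R^p z_1^q z_2^r):=p+q+r$, and for a sum of such terms (written in irreducible form) it is the minimum of the values of $\zeta$ over the terms. The kernel $\mathcal K_{\boldsymbol s}$ is assumed to be sufficiently smooth on the punctured disk $D_\varepsilon:=\{\boldsymbol z: 0<\|\boldsymbol z\|_2\le\varepsilon\}$ for some fixed $\varepsilon>0$. For a multi-index $\alpha=(\alpha_1,\alpha_2)\in\mathbb N_0^2$, $|\alpha|=\alpha_1+\alpha_2$ and $D^\alpha=\partial^{|\alpha|}/(\partial z_1^{\alpha_1}\partial z_2^{\alpha_2})$. The condition on $P^{[1]}_{m_2+3}$ ensures that $\mathcal K_{\boldsymbol s,n}$ does not vanish on a sufficiently small punctured disk about $\boldsymbol 0$, so $\rho$ is defined there; at the origin one sets $\rho(\boldsymbol 0)=1$. *)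

theory Defs
  imports "HOL-Analysis.Analysis" "HOL-Computational_Algebra.Polynomial"
begin

section \<open>Bivariate polynomials\<close>

text \<open>
  In a \<^typ>\<open>real poly poly\<close> the inner variable is $z_1$ and the outer one is $z_2$:
  the coefficient of $z_1^q z_2^r$ in \<open>P\<close> is \<open>coeff (coeff P r) q\<close>.
\<close>

definition eval2 :: "real poly poly \<Rightarrow> real ^ 2 \<Rightarrow> real" where
  "eval2 P z = poly (poly P [:z $ 2:]) (z $ 1)"

text \<open>As usual, the zero polynomial counts as homogeneous of every degree.\<close>

definition homogeneous2 :: "int \<Rightarrow> real poly poly \<Rightarrow> bool" where
  "homogeneous2 d P \<longleftrightarrow> (\<forall>q r. coeff (coeff P r) q \<noteq> 0 \<longrightarrow> int q + int r = d)"


section \<open>Partial derivatives and smoothness classes in the plane\<close>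

definition partial :: "2 \<Rightarrow> (real ^ 2 \<Rightarrow> real) \<Rightarrow> real ^ 2 \<Rightarrow> real" where
  "partial i f z = deriv (\<lambda>t. f (z + t *\<^sub>R axis i 1)) 0"

definition D :: "nat \<times> nat \<Rightarrow> (real ^ 2 \<Rightarrow> real) \<Rightarrow> real ^ 2 \<Rightarrow> real" where
  "D \<alpha> f = (partial 1 ^^ fst \<alpha>) ((partial 2 ^^ snd \<alpha>) f)"

text \<open>
  \<open>C_on k U f\<close>: all partial derivatives of \<open>f\<close> of order at most \<open>k\<close>, in whatever
  order of differentiation, exist and are continuous on \<open>U\<close>. Only meant for open \<open>U\<close>.
\<close>

primrec C_on :: "nat \<Rightarrow> (real ^ 2) set \<Rightarrow> (real ^ 2 \<Rightarrow> real) \<Rightarrow> bool" where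
  "C_on 0 U f \<longleftrightarrow> continuous_on U f"
| "C_on (Suc k) U f \<longleftrightarrow> continuous_on U f \<and>
     (\<forall>i. (\<forall>z\<in>U. (\<lambda>t. f (z + t *\<^sub>R axis i 1)) differentiable (at 0)) \<and> C_on k U (partial i f))"

definition C_at :: "nat \<Rightarrow> real ^ 2 \<Rightarrow> (real ^ 2 \<Rightarrow> real) \<Rightarrow> bool" where
  "C_at k z f \<longleftrightarrow> (\<exists>U. open U \<and> z \<in> U \<and> C_on k U f)"


section \<open>Singular kernels\<close>

definition punctured_disk :: "real \<Rightarrow> (real ^ 2) set" where
  "punctured_disk \<epsilon> = {z. 0 < norm z \<and> norm z \<le> \<epsilon>}"

definition R :: "real \<Rightarrow> real \<Rightarrow> real \<Rightarrow> real ^ 2 \<Rightarrow> real" where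
  "R a b c z = sqrt (a * (z $ 1)\<^sup>2 + b * z $ 1 * z $ 2 + c * (z $ 2)\<^sup>2)"

definition kernel_term ::
  "real \<Rightarrow> real \<Rightarrow> real \<Rightarrow> int \<Rightarrow> (nat \<Rightarrow> real poly poly) \<Rightarrow> nat \<Rightarrow> real ^ 2 \<Rightarrow> real" where
  "kernel_term a b c m1 P l z = R a b c z powi (- 2 * (int l + m1) + 1) * eval2 (P l) z"

definition truncated_kernel ::
  "real \<Rightarrow> real \<Rightarrow> real \<Rightarrow> int \<Rightarrow> (nat \<Rightarrow> real poly poly) \<Rightarrow> nat \<Rightarrow> real ^ 2 \<Rightarrow> real" where
  "truncated_kernel a b c m1 P n z = (\<Sum>l=1..n. kernel_term a b c m1 P l z)"

definition regularized_kernel ::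
  "(real ^ 2 \<Rightarrow> real) \<Rightarrow> (real ^ 2 \<Rightarrow> real) \<Rightarrow> real ^ 2 \<Rightarrow> real" where
  "regularized_kernel K Kn z = (if z = 0 then 1 else K z / Kn z)"

text \<open>
  \<open>(p, q, r)\<close> stands for the term $R^p z_1^q z_2^r$. Bringing a sum of such terms to
  irreducible form only cancels factors $R^2 = a z_1^2 + b z_1 z_2 + c z_2^2$, which
  does not affect $p + q + r$, so \<open>zeta\<close> may be taken over the expansion as given.
\<close>

definition kernel_monomials :: "int \<Rightarrow> (nat \<Rightarrow> real poly poly) \<Rightarrow> (int \<times> nat \<times> nat) set" where
  "kernel_monomials m1 P =
     {(- 2 * (int l + m1) + 1, q, r) | l q r. 1 \<le> l \<and> coeff (coeff (P l) r) q \<noteq> 0}"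

definition zeta :: "(int \<times> nat \<times> nat) set \<Rightarrow> int" where
  "zeta M = (LEAST k. \<exists>(p, q, r)\<in>M. k = p + int q + int r)"

text \<open>The minimum exists and has the expected value as soon as the first polynomial is nonzero.\<close>

lemma zeta_kernel_monomials:
  assumes hom: "\<And>l. 1 \<le> l \<Longrightarrow> homogeneous2 (3 * int l + m2) (P l)"
    and "P 1 \<noteq> 0"
  shows "zeta (kernel_monomials m1 P) = - 2 * m1 + m2 + 2"
  unfolding zeta_def
proof (rule Least_equality)
  from \<open>P 1 \<noteq> 0\<close> obtain r q where qr: "coeff (coeff (P 1) r) q \<noteq> 0"
    by (metis leading_coeff_0_iff)
  with hom[of 1] have "int q + int r = 3 + m2"
    by (auto simp: homogeneous2_def)
  moreover from qr have "(- 2 * (int 1 + m1) + 1, q, r) \<in> kernel_monomials m1 P"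
    unfolding kernel_monomials_def by blast
  ultimately show "\<exists>(p, q, r)\<in>kernel_monomials m1 P. - 2 * m1 + m2 + 2 = p + int q + int r"
    by (intro bexI[of _ "(- 2 * (int 1 + m1) + 1, q, r)"]) auto
next
  fix k assume "\<exists>(p, q, r)\<in>kernel_monomials m1 P. k = p + int q + int r"
  then obtain l q r where "1 \<le> l" "coeff (coeff (P l) r) q \<noteq> 0"
    and k: "k = - 2 * (int l + m1) + 1 + int q + int r"
    by (auto simp: kernel_monomials_def)
  with hom[of l] have "int q + int r = 3 * int l + m2"
    by (auto simp: homogeneous2_def)
  moreover from \<open>1 \<le> l\<close> have "1 \<le> int l"
    by simp
  ultimately show "- 2 * m1 + m2 + 2 \<le> k"
    using k by (simp add: algebra_simps)
qed

end

theory Submission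
  imports Defs "HOL-Complex_Analysis.Conformal_Mappings"
begin

text \<open>
  Let \<open>m = - 2 * m1 + m2 + 2\<close>. The \<open>l\<close>-th term of the expansion is homogeneous of degree \<open>l + m - 1\<close>.
  Hence \<open>Kn\<close> should be comparable with \<open>norm z powi m\<close> near the origin, and the remainder \<open>K - Kn\<close>,
  which starts with the term of index \<open>n + 1\<close>, should be of order \<open>n + m\<close>. Then the quotient
  \<open>\<rho> - 1 = (K - Kn) / Kn\<close> is of order \<open>n\<close>. If moreover each derivative costs exactly one order, then the
  derivatives of \<open>\<rho> - 1\<close> up to order \<open>n - 1\<close> tend to 0 at the origin, so that \<open>\<rho>\<close> is \<open>n - 1\<close> times
  continuously differentiable there and these derivatives vanish (\<open>symbol_flat\<close>, \<open>D_flat\<close>).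

  The loss of one order per derivative is expressed by \<open>symbol_family\<close>, a class of sequences of
  functions that contains homogeneous polynomials and powers of \<open>R\<close> and that is closed under products
  and, in the presence of a lower bound, under inverses. The constants may grow geometrically along
  the sequence, because then the factor \<open>norm z ^ l\<close> makes the series of the functions and of their
  derivatives converge near the origin (\<open>symbol_family_suminf\<close>).

  What remains is that the polynomials \<open>P l\<close> do grow at most geometrically in \<open>l\<close> on the unit ball. This
  is not obvious, because the expansion converges only pointwise: a priori the terms might be
  arbitrarily large near some directions. By Baire's theorem, however, the terms are uniformly bounded
  on some ball (\<open>pointwise_bounded_imp_bounded_on_ball\<close>). On each line through its centre, \<open>P l\<close> is
  a polynomial in one variable whose degree is at most linear in \<open>l\<close> and which is controlled on a
  segment. By an inequality of Bernstein and Walsh (\<open>bernstein_walsh\<close>) it is then controlled on the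
  whole line, at the price of a constant to the power of the degree, and this price is geometric in \<open>l\<close>.
  The same inequality, combined with Cauchy's estimate, controls the derivatives.
\<close>

section \<open>Growth of polynomials away from a segment\<close>

text \<open>
  The roots of \<open>u\<^sup>2 - 2 * z * u + 1\<close> have product 1, so one of them lies in the closed unit disc.
\<close>

lemma joukowski_surj:
  fixes z :: complex
  obtains u where "u \<noteq> 0" "norm u \<le> 1" "z = (u + 1 / u) / 2"
proof -
  define w where "w = z + csqrt (z\<^sup>2 - 1)"
  define w' where "w' = z - csqrt (z\<^sup>2 - 1)"
  have ww: "w * w' = 1"
    using square_diff_square_factored[of z "csqrt (z\<^sup>2 - 1)"]
    by (simp add: w_def w'_def power2_eq_square[symmetric])
  have "w \<noteq> 0" "w' \<noteq> 0" using ww by auto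
  have w': "w' = 1 / w" using ww \<open>w \<noteq> 0\<close> by (simp add: field_simps)
  have w: "w = 1 / w'" using ww \<open>w' \<noteq> 0\<close> by (simp add: field_simps)
  have s: "z = (w + w') / 2" by (simp add: w_def w'_def)
  have "norm w * norm w' = 1" using ww by (metis norm_mult norm_one)
  then have "norm w \<le> 1 \<or> norm w' \<le> 1"
    by (smt (verit) mult_less_cancel_right1 norm_ge_zero)
  then show thesis
  proof
    assume "norm w \<le> 1"
    with \<open>w \<noteq> 0\<close> s w' show thesis by (intro that) auto
  next
    assume "norm w' \<le> 1"
    with \<open>w' \<noteq> 0\<close> s w show thesis by (intro that[of w']) (auto simp: add.commute)
  qed
qed

lemma poly_eq_sum_le_degree_bound:
  fixes q :: "'a::comm_ring_1 poly"
  assumes "degree q \<le> d"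
  shows "poly q x = (\<Sum>k\<le>d. coeff q k * x ^ k)"
proof -
  have "poly q x = (\<Sum>k\<le>degree q. coeff q k * x ^ k)" by (rule poly_altdef)
  also have "\<dots> = (\<Sum>k\<le>d. coeff q k * x ^ k)"
    using assms by (intro sum.mono_neutral_left) (auto simp: coeff_eq_0)
  finally show ?thesis .
qed

text \<open>
  The Joukowski map \<open>u \<mapsto> (u + 1 / u) / 2\<close> sends the unit circle onto the segment from -1 to 1
  and the punctured unit disc onto the whole plane. It turns \<open>q\<close>, multiplied by \<open>u ^ d\<close>, into a
  polynomial in \<open>u\<close> that is at most \<open>M\<close> on the circle, hence on the disc by the maximum principle.
  The factor \<open>u ^ d\<close> is then removed with \<open>norm (1 / u) \<le> 2 * norm z + 1\<close>.
\<close>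

lemma bernstein_walsh:
  fixes q :: "complex poly"
  assumes deg: "degree q \<le> d"
    and bound: "\<And>x. \<bar>x\<bar> \<le> 1 \<Longrightarrow> norm (poly q (of_real x)) \<le> M"
  shows "norm (poly q z) \<le> M * (2 * norm z + 1) ^ d"
proof -
  \<comment> \<open>the product of \<open>u ^ d\<close> and \<open>poly q ((u + 1 / u) / 2)\<close>, freed of denominators\<close>
  define g where "g u = (\<Sum>k\<le>d. coeff q k * (u ^ (d - k) * ((1 + u\<^sup>2) / 2) ^ k))" for u
  have g: "g u = u ^ d * poly q ((u + 1 / u) / 2)" if "u \<noteq> 0" for u
  proof -
    have "u ^ (d - k) * ((1 + u\<^sup>2) / 2) ^ k = u ^ d * ((u + 1 / u) / 2) ^ k" if "k \<le> d" for k
    proof -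
      have "(1 + u\<^sup>2) / 2 = u * ((u + 1 / u) / 2)"
        using \<open>u \<noteq> 0\<close> by (simp add: field_simps power2_eq_square)
      then have "((1 + u\<^sup>2) / 2) ^ k = u ^ k * ((u + 1 / u) / 2) ^ k"
        by (simp only: power_mult_distrib)
      moreover have "u ^ (d - k) * u ^ k = u ^ d"
        using that by (simp flip: power_add)
      ultimately show ?thesis
        by (metis mult.assoc)
    qed
    then show ?thesis
      unfolding g_def poly_eq_sum_le_degree_bound[OF deg] sum_distrib_left
      by (intro sum.cong) (auto simp: mult_ac)
  qed
  have circle: "norm (g u) \<le> M" if "norm u = 1" for u
  proof -
    have "u \<noteq> 0" using that by auto
    have "u * cnj u = 1"
      using that by (simp flip: complex_norm_square)
    then have "1 / u = cnj u"
      using \<open>u \<noteq> 0\<close> by (simp add: field_simps)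
    then have "(u + 1 / u) / 2 = of_real (Re u)"
      by (simp add: complex_add_cnj)
    moreover have "\<bar>Re u\<bar> \<le> 1" using abs_Re_le_cmod[of u] that by simp
    ultimately show ?thesis
      using bound[of "Re u"] that by (simp add: g[OF \<open>u \<noteq> 0\<close>] norm_mult norm_power)
  qed
  have disc: "norm (g u) \<le> M" if "norm u \<le> 1" for u
  proof (rule maximum_modulus_frontier[of g "cball 0 1"])
    show "g holomorphic_on interior (cball 0 1)"
      unfolding g_def by (intro holomorphic_intros) auto
    show "continuous_on (closure (cball 0 1)) g"
      unfolding g_def by (intro continuous_intros) auto
  qed (use circle that in \<open>auto simp: frontier_cball\<close>)
  obtain u where u: "u \<noteq> 0" "norm u \<le> 1" "z = (u + 1 / u) / 2"
    by (rule joukowski_surj)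
  have "1 / u = 2 * z - u" unfolding u(3) by (simp add: field_simps)
  then have "norm (1 / u) \<le> norm (2 * z) + norm u"
    using norm_triangle_ineq4[of "2 * z" u] by simp
  then have inv_u: "norm (1 / u) \<le> 2 * norm z + 1"
    using u(2) by (simp only: norm_mult) simp
  have "poly q z = g u * (1 / u) ^ d"
    unfolding g[OF u(1)] u(3)[symmetric] using u(1) by (simp add: power_one_over)
  then have "norm (poly q z) = norm (g u) * norm (1 / u) ^ d"
    by (simp only: norm_mult norm_power)
  also have "\<dots> \<le> M * (2 * norm z + 1) ^ d"
    using disc[OF u(2)] inv_u order_trans[OF norm_ge_zero disc[OF u(2)]]
    by (intro mult_mono power_mono) auto
  finally show ?thesis .
qed

lemma poly_map_poly_of_real:
  "poly (map_poly of_real p) (of_real x :: complex) = of_real (poly p x)"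
  by (induction p) (simp_all add: map_poly_pCons)

lemma real_poly_growth:
  fixes p :: "real poly"
  assumes "degree p \<le> d" and "\<And>x. \<bar>x\<bar> \<le> 1 \<Longrightarrow> \<bar>poly p x\<bar> \<le> M"
  shows "\<bar>poly p x\<bar> \<le> M * (2 * \<bar>x\<bar> + 1) ^ d"
  using bernstein_walsh[of "map_poly of_real p" d M "of_real x"] assms
  by (simp add: poly_map_poly_of_real degree_map_poly)

text \<open>
  The linear coefficient is the derivative at 0. Cauchy's estimate bounds it by the maximum on the
  unit circle, where the growth factor \<open>2 * norm z + 1\<close> is 3.
\<close>

lemma real_poly_linear_coeff_bound:
  fixes p :: "real poly"
  assumes deg: "degree p \<le> d" and bound: "\<And>x. \<bar>x\<bar> \<le> 1 \<Longrightarrow> \<bar>poly p x\<bar> \<le> M"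
  shows "\<bar>coeff p 1\<bar> \<le> M * 3 ^ d"
proof -
  define q :: "complex poly" where "q = map_poly of_real p"
  have "norm ((deriv ^^ 1) (poly q) 0) \<le> fact 1 * (M * 3 ^ d) / 1 ^ 1"
  proof (rule Cauchy_inequality)
    show "norm (poly q x) \<le> M * 3 ^ d" if "norm (0 - x) = 1" for x
      using bernstein_walsh[of q d M x] that deg bound
      by (simp add: q_def poly_map_poly_of_real degree_map_poly)
  qed (auto intro!: holomorphic_intros continuous_intros)
  moreover have "deriv (poly q) 0 = of_real (coeff p 1)"
    using DERIV_imp_deriv[OF poly_DERIV[of q 0]]
    by (simp add: poly_0_coeff_0 coeff_pderiv q_def coeff_map_poly)
  ultimately show ?thesis by simp
qed

section \<open>Homogeneous polynomials in two variables\<close>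

lemma eval2_0 [simp]: "eval2 0 z = 0"
  by (simp add: eval2_def)

lemma eval2_pCons [simp]: "eval2 (pCons p P) z = poly p (z $ 1) + z $ 2 * eval2 P z"
  by (simp add: eval2_def)

lemma eval2_add [simp]: "eval2 (P + P') z = eval2 P z + eval2 P' z"
  by (simp add: eval2_def)

lemma continuous_on_eval2 [continuous_intros]: "continuous_on S (eval2 P)"
  by (induction P) (auto intro!: continuous_intros)

lemma eval2_eq_sum:
  "eval2 P z = (\<Sum>r\<le>degree P. \<Sum>q\<le>degree (coeff P r). coeff (coeff P r) q * (z $ 1 ^ q * z $ 2 ^ r))"
proof -
  have "eval2 P z = (\<Sum>r\<le>degree P. poly (coeff P r) (z $ 1) * z $ 2 ^ r)"
    unfolding eval2_def
    by (simp add: poly_altdef[of P] poly_sum poly_power)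
  also have "\<dots> = (\<Sum>r\<le>degree P. \<Sum>q\<le>degree (coeff P r). coeff (coeff P r) q * (z $ 1 ^ q * z $ 2 ^ r))"
    by (simp only: poly_altdef[of "coeff P _"] sum_distrib_right mult.assoc)
  finally show ?thesis .
qed

lemma homogeneous2_negative:
  assumes "homogeneous2 d P" "d < 0"
  shows "P = 0"
  using assms by (auto simp: homogeneous2_def intro!: poly_eqI)

lemma eval2_scale:
  assumes "homogeneous2 (int d) P"
  shows "eval2 P (t *\<^sub>R z) = t ^ d * eval2 P z"
proof -
  have "coeff (coeff P r) q * ((t * z $ 1) ^ q * (t * z $ 2) ^ r)
      = t ^ d * (coeff (coeff P r) q * (z $ 1 ^ q * z $ 2 ^ r))" for q r
  proof (cases "coeff (coeff P r) q = 0")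
    case False
    then have "int q + int r = int d" using assms by (simp add: homogeneous2_def)
    then have "d = q + r" by linarith
    then show ?thesis by (simp add: power_mult_distrib power_add)
  qed simp
  then show ?thesis
    by (simp only: eval2_eq_sum sum_distrib_left vector_scaleR_component real_scaleR_def)
qed

text \<open>
  Lines carry the estimates for polynomials in one variable over to the plane.
\<close>

lemma eval2_on_line:
  assumes "homogeneous2 (int d) P"
  obtains p where "degree p \<le> d" "\<And>t. poly p t = eval2 P (z + t *\<^sub>R v)"
proof
  define p where "p = (\<Sum>r\<le>degree P. \<Sum>q\<le>degree (coeff P r).
    smult (coeff (coeff P r) q) ([:z $ 1, v $ 1:] ^ q * [:z $ 2, v $ 2:] ^ r))"
  show "poly p t = eval2 P (z + t *\<^sub>R v)" for t
    by (simp add: p_def eval2_eq_sum poly_sum poly_power)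
  show "degree p \<le> d"
    unfolding p_def
  proof (intro degree_sum_le finite_atMost)
    fix q r
    show "degree (smult (coeff (coeff P r) q) ([:z $ 1, v $ 1:] ^ q * [:z $ 2, v $ 2:] ^ r)) \<le> d"
    proof (cases "coeff (coeff P r) q = 0")
      case False
      then have "int q + int r = int d" using assms by (simp add: homogeneous2_def)
      then have d: "d = q + r" by linarith
      have lin: "degree ([:x, y:] ^ k) \<le> k" for x y :: real and k
        using degree_power_le[of "[:x, y:]" k] by (auto split: if_splits intro: order_trans)
      have "degree ([:z $ 1, v $ 1:] ^ q * [:z $ 2, v $ 2:] ^ r) \<le> q + r"
        using degree_mult_le add_mono[OF lin lin] order_trans by blast
      with d False show ?thesis by simp
    qed simp
  qed
qed

text \<open>
  The partial derivative with respect to the \<open>i\<close>-th variable: \<open>z\<^sub>1\<close> is the variable of the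
  inner polynomials and \<open>z\<^sub>2\<close> that of the outer one.
\<close>

definition pderiv2 :: "2 \<Rightarrow> real poly poly \<Rightarrow> real poly poly" where
  "pderiv2 i P = (if i = 1 then map_poly pderiv P else pderiv P)"

lemma coeff_pderiv2_1: "coeff (coeff (pderiv2 1 P) r) q = of_nat (Suc q) * coeff (coeff P r) (Suc q)"
  by (simp add: pderiv2_def coeff_map_poly coeff_pderiv)

lemma coeff_pderiv2_2: "coeff (coeff (pderiv2 2 P) r) q = of_nat (Suc r) * coeff (coeff P (Suc r)) q"
proof -
  have "coeff (coeff (pderiv2 2 P) r) q = coeff (of_nat (Suc r) * coeff P (Suc r)) q"
    by (simp add: pderiv2_def coeff_pderiv del: of_nat_Suc)
  also have "of_nat (Suc r) * coeff P (Suc r) = smult (of_nat (Suc r)) (coeff P (Suc r))"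
    by (simp add: of_nat_poly)
  finally show ?thesis by simp
qed

lemma homogeneous2_pderiv2:
  assumes "homogeneous2 d P"
  shows "homogeneous2 (d - 1) (pderiv2 i P)"
proof -
  have i: "i = 1 \<or> i = 2" using exhaust_2 by blast
  show ?thesis
    unfolding homogeneous2_def
  proof (intro allI impI)
    fix q r assume "coeff (coeff (pderiv2 i P) r) q \<noteq> 0"
    then have "coeff (coeff P r) (Suc q) \<noteq> 0 \<or> coeff (coeff P (Suc r)) q \<noteq> 0"
      using i by (auto simp: coeff_pderiv2_1 coeff_pderiv2_2)
    then have "int (Suc q) + int r = d \<or> int q + int (Suc r) = d"
      using assms unfolding homogeneous2_def by blast
    then show "int q + int r = d - 1" by auto
  qed
qed

lemma eval2_has_partial:
  "((\<lambda>t. eval2 P (z + t *\<^sub>R axis i 1)) has_real_derivative eval2 (pderiv2 i P) z) (at 0)"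
proof (induction P)
  case 0
  then show ?case by (simp add: pderiv2_def)
next
  case (pCons p P)
  have i: "i = 1 \<or> i = 2" using exhaust_2 by blast
  have "((\<lambda>t. poly p ((z + t *\<^sub>R axis i 1) $ 1) + (z + t *\<^sub>R axis i 1) $ 2 * eval2 P (z + t *\<^sub>R axis i 1))
     has_real_derivative poly (pderiv p) (z $ 1) * (axis i 1 $ 1) +
      (axis i 1 $ 2 * eval2 P z + z $ 2 * eval2 (pderiv2 i P) z)) (at 0)"
    by (rule derivative_eq_intros DERIV_chain2[OF poly_DERIV] refl pCons.IH | simp)+
  moreover have "poly (pderiv p) (z $ 1) * (axis i 1 $ 1) +
      (axis i 1 $ 2 * eval2 P z + z $ 2 * eval2 (pderiv2 i P) z) = eval2 (pderiv2 i (pCons p P)) z"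
    using i by (auto simp: pderiv2_def axis_def map_poly_pCons pderiv_pCons)
  ultimately show ?case by simp
qed

text \<open>
  With \<open>Suc l\<close> instead of \<open>l\<close> in the exponent, one constant serves both as growth rate and as
  constant factor: products of such bounds, and powers \<open>A ^ d\<close> with \<open>d\<close> at most linear in \<open>l\<close>,
  are again of this form. By homogeneity the bounds control the polynomials in the whole plane.
\<close>

definition unit_ball_bounded :: "(nat \<Rightarrow> real poly poly) \<Rightarrow> bool" where
  "unit_ball_bounded P \<longleftrightarrow> (\<exists>A\<ge>1. \<forall>l z. norm z \<le> 1 \<longrightarrow> \<bar>eval2 (P l) z\<bar> \<le> A ^ Suc l)"

lemma power_le_geometric:
  assumes "(A::real) \<ge> 1" "d \<le> B * Suc l"
  shows "A ^ d \<le> (A ^ B) ^ Suc l"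
  using power_increasing[OF assms(2,1)] by (simp only: power_mult)

text \<open>
  The partial derivative is the linear coefficient of the restriction to a line segment of length 2
  centred at \<open>z\<close>. The segment stays in the ball of radius 2, where homogeneity costs a factor
  \<open>2 ^ k\<close>, and the estimate of the coefficient costs \<open>3 ^ k\<close>. Since the degrees grow at most linearly
  in \<open>l\<close>, both factors are geometric.
\<close>

lemma unit_ball_bounded_pderiv2:
  assumes bnd: "unit_ball_bounded P"
    and hom: "\<And>l. homogeneous2 (d l) (P l)"
    and deg: "\<And>l. d l \<le> int (B * Suc l)"
  shows "unit_ball_bounded (\<lambda>l. pderiv2 i (P l))"
proof -
  from bnd obtain A where A: "A \<ge> 1" "\<And>l z. norm z \<le> 1 \<Longrightarrow> \<bar>eval2 (P l) z\<bar> \<le> A ^ Suc l"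
    unfolding unit_ball_bounded_def by blast
  have "\<bar>eval2 (pderiv2 i (P l)) z\<bar> \<le> (6 ^ B * A) ^ Suc l" if z: "norm z \<le> 1" for l z
  proof (cases "d l < 0")
    case True
    then have "P l = 0" using hom homogeneous2_negative by blast
    then show ?thesis using A(1) by (simp add: pderiv2_def)
  next
    case False
    define k where "k = nat (d l)"
    have k: "homogeneous2 (int k) (P l)" "k \<le> B * Suc l"
      using False hom[of l] deg[of l] by (auto simp: k_def nat_le_iff)
    obtain p where p: "degree p \<le> k" "\<And>t. poly p t = eval2 (P l) (z + t *\<^sub>R axis i 1)"
      using eval2_on_line[OF k(1)] by blast
    have "\<bar>poly p t\<bar> \<le> 2 ^ k * A ^ Suc l" if t: "\<bar>t\<bar> \<le> 1" for t
    proof -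
      have "norm (z + t *\<^sub>R axis i 1) \<le> 2"
        using norm_triangle_ineq[of z "t *\<^sub>R axis i 1"] z t by simp
      then have "\<bar>eval2 (P l) ((1/2) *\<^sub>R (z + t *\<^sub>R axis i 1))\<bar> \<le> A ^ Suc l"
        by (intro A) simp
      moreover have "eval2 (P l) (z + t *\<^sub>R axis i 1)
          = 2 ^ k * eval2 (P l) ((1/2) *\<^sub>R (z + t *\<^sub>R axis i 1))"
        using eval2_scale[OF k(1), of 2 "(1/2) *\<^sub>R (z + t *\<^sub>R axis i 1)"] by simp
      ultimately show ?thesis
        by (simp add: p abs_mult mult_left_mono del: power_Suc)
    qed
    then have "\<bar>coeff p 1\<bar> \<le> 2 ^ k * A ^ Suc l * 3 ^ k"
      by (rule real_poly_linear_coeff_bound[OF p(1)])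
    also have "\<dots> = 6 ^ k * A ^ Suc l"
      by (simp add: mult_ac flip: power_mult_distrib)
    also have "\<dots> \<le> (6 ^ B) ^ Suc l * A ^ Suc l"
      using A(1) k(2) by (intro mult_right_mono power_le_geometric) auto
    also have "\<dots> = (6 ^ B * A) ^ Suc l" by (simp only: power_mult_distrib)
    finally have "\<bar>coeff p 1\<bar> \<le> (6 ^ B * A) ^ Suc l" .
    moreover have "eval2 (pderiv2 i (P l)) z = coeff p 1"
    proof (rule DERIV_unique)
      show "(poly p has_real_derivative eval2 (pderiv2 i (P l)) z) (at 0)"
        using eval2_has_partial[of "P l" z i] by (simp only: p(2)[symmetric])
      show "(poly p has_real_derivative coeff p 1) (at 0)"
        using poly_DERIV[of p 0] by (simp add: poly_0_coeff_0 coeff_pderiv)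
    qed
    ultimately show ?thesis by simp
  qed
  moreover have "6 ^ B * A \<ge> 1"
    using mult_mono[of 1 "6 ^ B" 1 A] A(1) by simp
  ultimately show ?thesis
    unfolding unit_ball_bounded_def by blast
qed

text \<open>
  Every point of the unit ball lies on a line through the centre \<open>w\<close> of the small ball. On a
  segment around \<open>w\<close> the polynomials are bounded by assumption, and polynomial growth along the
  line transports the bound to \<open>z\<close>.
\<close>

lemma unit_ball_bounded_from_ball:
  assumes hom: "\<And>l. homogeneous2 (d l) (P l)"
    and deg: "\<And>l. d l \<le> int (B * Suc l)"
    and r: "r > 0" and A: "A \<ge> 1"
    and bound: "\<And>l z. z \<in> ball w r \<Longrightarrow> \<bar>eval2 (P l) z\<bar> \<le> A ^ Suc l"
  shows "unit_ball_bounded P"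
proof -
  define C where "C = 4 * (1 + norm w) / r + 1"
  have "C \<ge> 1" using r by (simp add: C_def)
  have "\<bar>eval2 (P l) z\<bar> \<le> (A * C ^ B) ^ Suc l" if z: "norm z \<le> 1" for l z
  proof (cases "d l < 0")
    case True
    then have "P l = 0" using hom homogeneous2_negative by blast
    then show ?thesis using A \<open>C \<ge> 1\<close> by simp
  next
    case False
    define k where "k = nat (d l)"
    have k: "homogeneous2 (int k) (P l)" "k \<le> B * Suc l"
      using False hom[of l] deg[of l] by (auto simp: k_def nat_le_iff)
    have nzw: "norm (z - w) \<le> 1 + norm w"
      using norm_triangle_ineq4[of z w] z by simp
    \<comment> \<open>the line is parametrised so that \<open>s\<close> is mapped to \<open>z\<close>, and the parameters of modulus at most 1
      stay within distance \<open>r / 2\<close> of \<open>w\<close>\<close>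
    define s where "s = 2 * (1 + norm w) / r"
    have "s > 0" using r by (simp add: s_def add_pos_nonneg)
    obtain p where p: "degree p \<le> k" "\<And>t. poly p t = eval2 (P l) (w + t *\<^sub>R ((1 / s) *\<^sub>R (z - w)))"
      using eval2_on_line[OF k(1)] by blast
    have "\<bar>poly p t\<bar> \<le> A ^ Suc l" if "\<bar>t\<bar> \<le> 1" for t
      unfolding p(2)
    proof (rule bound)
      have "norm (z - w) / s \<le> r / 2"
        using mult_left_mono[OF nzw, of r] r \<open>s > 0\<close> by (simp add: s_def field_simps)
      then have "\<bar>t\<bar> * (norm (z - w) / s) \<le> 1 * (r / 2)"
        using that \<open>s > 0\<close> by (intro mult_mono) auto
      then have "\<bar>t\<bar> * (norm (z - w) / s) < r"
        using r by linarith
      then show "w + t *\<^sub>R ((1 / s) *\<^sub>R (z - w)) \<in> ball w r"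
        using \<open>s > 0\<close> by (simp add: dist_norm)
    qed
    then have "\<bar>poly p s\<bar> \<le> A ^ Suc l * (2 * \<bar>s\<bar> + 1) ^ k"
      by (rule real_poly_growth[OF p(1)])
    also have "2 * \<bar>s\<bar> + 1 = C" using \<open>s > 0\<close> using r by (simp add: s_def C_def)
    also have "A ^ Suc l * C ^ k \<le> A ^ Suc l * (C ^ B) ^ Suc l"
      using A \<open>C \<ge> 1\<close> k(2) by (intro mult_left_mono power_le_geometric) auto
    also have "\<dots> = (A * C ^ B) ^ Suc l" by (simp only: power_mult_distrib)
    finally show ?thesis using \<open>s > 0\<close> by (simp add: p(2))
  qed
  moreover have "A * C ^ B \<ge> 1"
    using mult_mono[of 1 A 1 "C ^ B"] A \<open>C \<ge> 1\<close> by simp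
  ultimately show ?thesis
    unfolding unit_ball_bounded_def by blast
qed

section \<open>Partial derivatives\<close>

definition pdiff :: "2 \<Rightarrow> (real ^ 2 \<Rightarrow> real) \<Rightarrow> real ^ 2 \<Rightarrow> bool" where
  "pdiff i f z \<longleftrightarrow> (\<lambda>t. f (z + t *\<^sub>R axis i 1)) differentiable (at 0)"

lemma pdiff_iff:
  "pdiff i f z \<longleftrightarrow> ((\<lambda>t. f (z + t *\<^sub>R axis i 1)) has_real_derivative partial i f z) (at 0)"
  unfolding pdiff_def partial_def by (rule DERIV_deriv_iff_real_differentiable[symmetric])

lemma partialI:
  assumes "((\<lambda>t. f (z + t *\<^sub>R axis i 1)) has_real_derivative d) (at 0)"
  shows "pdiff i f z" "partial i f z = d"
  using assms DERIV_imp_deriv[OF assms]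
  unfolding pdiff_def partial_def real_differentiable_def by auto

lemma pdiff_along_line:
  assumes "pdiff i f (z + t *\<^sub>R axis i 1)"
  shows "((\<lambda>t. f (z + t *\<^sub>R axis i 1)) has_real_derivative partial i f (z + t *\<^sub>R axis i 1)) (at t)"
  using assms DERIV_shift[of "\<lambda>t. f (z + t *\<^sub>R axis i 1)" _ 0 t]
  by (simp add: pdiff_iff scaleR_add_left algebra_simps)

lemma partial_cong_open:
  assumes "open U" "z \<in> U" and eq: "\<And>y. y \<in> U \<Longrightarrow> f y = g y"
  shows "pdiff i f z \<longleftrightarrow> pdiff i g z" "partial i f z = partial i g z"
proof -
  have "((\<lambda>t. z + t *\<^sub>R axis i 1) \<longlongrightarrow> z + 0 *\<^sub>R axis i 1) (nhds 0)"
    by (intro tendsto_intros filterlim_ident)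
  then have "\<forall>\<^sub>F t in nhds 0. z + t *\<^sub>R axis i 1 \<in> U"
    using assms(1,2) by (simp add: tendsto_def)
  then have "\<forall>\<^sub>F t in nhds 0. f (z + t *\<^sub>R axis i 1) = g (z + t *\<^sub>R axis i 1)"
    by eventually_elim (rule eq)
  then have *: "((\<lambda>t. f (z + t *\<^sub>R axis i 1)) has_real_derivative d) (at 0) \<longleftrightarrow>
      ((\<lambda>t. g (z + t *\<^sub>R axis i 1)) has_real_derivative d) (at 0)" for d
    by (intro DERIV_cong_ev) auto
  show "pdiff i f z \<longleftrightarrow> pdiff i g z"
    unfolding pdiff_def real_differentiable_def by (simp only: *)
  show "partial i f z = partial i g z"
    unfolding partial_def deriv_def by (simp only: *)
qed

lemma C_on_Suc:
  "C_on (Suc k) U f \<longleftrightarrow> continuous_on U f \<and> (\<forall>i. (\<forall>z\<in>U. pdiff i f z) \<and> C_on k U (partial i f))"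
  by (simp add: pdiff_def)

section \<open>Geometric symbol families\<close>

text \<open>
  The \<open>l\<close>-th function is of order \<open>norm z powi \<kappa> l\<close> with a constant that grows at most geometrically
  in \<open>l\<close>. Geometric growth is what a power series in \<open>norm z\<close> tolerates. A single function is
  treated as a constant family.
\<close>

definition geom_bounded :: "(real ^ 2) set \<Rightarrow> (nat \<Rightarrow> int) \<Rightarrow> (nat \<Rightarrow> real ^ 2 \<Rightarrow> real) \<Rightarrow> bool" where
  "geom_bounded U \<kappa> f \<longleftrightarrow> (\<exists>A\<ge>1. \<forall>l. \<forall>z\<in>U. \<bar>f l z\<bar> \<le> A ^ Suc l * norm z powi \<kappa> l)"

text \<open>
  Homogeneous functions lose one order with each derivative. A symbol family does so in the sense
  of estimates, up to derivatives of order \<open>j\<close>, with geometric constants for each derivative.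
\<close>

primrec symbol_family ::
  "nat \<Rightarrow> (real ^ 2) set \<Rightarrow> (nat \<Rightarrow> int) \<Rightarrow> (nat \<Rightarrow> real ^ 2 \<Rightarrow> real) \<Rightarrow> bool" where
  "symbol_family 0 U \<kappa> f \<longleftrightarrow> (\<forall>l. continuous_on U (f l)) \<and> geom_bounded U \<kappa> f"
| "symbol_family (Suc j) U \<kappa> f \<longleftrightarrow> ((\<forall>l. continuous_on U (f l)) \<and> geom_bounded U \<kappa> f) \<and>
     (\<forall>i. (\<forall>l. \<forall>z\<in>U. pdiff i (f l) z) \<and>
          symbol_family j U (\<lambda>l. \<kappa> l - 1) (\<lambda>l. partial i (f l)))"

lemma geom_boundedE:
  assumes "geom_bounded U \<kappa> f"
  obtains A where "A \<ge> 1" "\<And>l z. z \<in> U \<Longrightarrow> \<bar>f l z\<bar> \<le> A ^ Suc l * norm z powi \<kappa> l"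
  using assms unfolding geom_bounded_def by blast

lemma geom_boundedI:
  assumes "A \<ge> 1" "\<And>l z. z \<in> U \<Longrightarrow> \<bar>f l z\<bar> \<le> A ^ Suc l * norm z powi \<kappa> l"
  shows "geom_bounded U \<kappa> f"
  using assms unfolding geom_bounded_def by blast

lemma symbol_family_0:
  "symbol_family j U \<kappa> f \<Longrightarrow> (\<forall>l. continuous_on U (f l)) \<and> geom_bounded U \<kappa> f"
  by (cases j) auto

lemma symbol_family_SucD: "symbol_family (Suc j) U \<kappa> f \<Longrightarrow> symbol_family j U \<kappa> f"
  by (induction j arbitrary: \<kappa> f) auto

lemma symbol_family_mono: "symbol_family j U \<kappa> f \<Longrightarrow> j' \<le> j \<Longrightarrow> symbol_family j' U \<kappa> f"
  by (induction j) (auto simp: le_Suc_eq dest: symbol_family_SucD simp del: symbol_family.simps)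

lemma geom_bounded_subset: "geom_bounded U \<kappa> f \<Longrightarrow> V \<subseteq> U \<Longrightarrow> geom_bounded V \<kappa> f"
  unfolding geom_bounded_def by blast

lemma symbol_family_subset:
  "symbol_family j U \<kappa> f \<Longrightarrow> V \<subseteq> U \<Longrightarrow> symbol_family j V \<kappa> f"
proof (induction j arbitrary: \<kappa> f)
  case 0
  then show ?case by (auto intro: continuous_on_subset geom_bounded_subset)
next
  case (Suc j)
  then show ?case by (simp, blast intro: continuous_on_subset geom_bounded_subset)
qed

lemma geom_bounded_cong:
  assumes "\<And>l z. z \<in> U \<Longrightarrow> f l z = g l z"
  shows "geom_bounded U \<kappa> f \<longleftrightarrow> geom_bounded U \<kappa> g"
  using assms unfolding geom_bounded_def by simp

lemma symbol_family_cong: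
  assumes "open U"
  shows "(\<And>l z. z \<in> U \<Longrightarrow> f l z = g l z) \<Longrightarrow> symbol_family j U \<kappa> f \<longleftrightarrow> symbol_family j U \<kappa> g"
proof (induction j arbitrary: \<kappa> f g)
  case 0
  then show ?case
    using geom_bounded_cong[of U f g \<kappa>] by (simp cong: continuous_on_cong)
next
  case (Suc j)
  have "symbol_family j U (\<lambda>l. \<kappa> l - 1) (\<lambda>l. partial i (f l)) \<longleftrightarrow>
        symbol_family j U (\<lambda>l. \<kappa> l - 1) (\<lambda>l. partial i (g l))" for i
    using partial_cong_open(2)[OF assms] Suc.prems by (intro Suc.IH) blast
  moreover have "pdiff i (f l) z \<longleftrightarrow> pdiff i (g l) z" if "z \<in> U" for i l z
    using partial_cong_open(1)[OF assms that] Suc.prems by blast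
  ultimately show ?case
    using geom_bounded_cong[of U f g \<kappa>] Suc.prems by (simp cong: continuous_on_cong)
qed

text \<open>
  Both tails (\<open>\<sigma> l = l + s\<close>) and single members (\<open>\<sigma> l = s\<close>) of a family are obtained in this way;
  the condition on \<open>\<sigma>\<close> keeps the constants geometric.
\<close>

lemma symbol_family_reindex:
  assumes "\<And>l. \<sigma> l \<le> l + s"
  shows "symbol_family j U \<kappa> f \<Longrightarrow> symbol_family j U (\<lambda>l. \<kappa> (\<sigma> l)) (\<lambda>l. f (\<sigma> l))"
proof -
  have bnd: "geom_bounded U (\<lambda>l. \<kappa> (\<sigma> l)) (\<lambda>l. f (\<sigma> l))" if "geom_bounded U \<kappa> f" for \<kappa> f
  proof -
    from that obtain A where A: "A \<ge> 1" "\<And>l z. z \<in> U \<Longrightarrow> \<bar>f l z\<bar> \<le> A ^ Suc l * norm z powi \<kappa> l"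
      by (rule geom_boundedE) blast
    have "\<bar>f (\<sigma> l) z\<bar> \<le> (A ^ Suc s) ^ Suc l * norm z powi \<kappa> (\<sigma> l)" if "z \<in> U" for l z
    proof -
      have "Suc (\<sigma> l) \<le> Suc s * Suc l" using assms[of l] by simp
      then have "A ^ Suc (\<sigma> l) \<le> (A ^ Suc s) ^ Suc l"
        using A(1) by (intro power_le_geometric)
      then show ?thesis
        using A(2)[OF that, of "\<sigma> l"]
        by (meson mult_right_mono order_trans zero_le_power_int norm_ge_zero)
    qed
    moreover have "A ^ Suc s \<ge> 1" using A(1) by (rule one_le_power)
    ultimately show ?thesis by (intro geom_boundedI)
  qed
  show "symbol_family j U \<kappa> f \<Longrightarrow> symbol_family j U (\<lambda>l. \<kappa> (\<sigma> l)) (\<lambda>l. f (\<sigma> l))"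
    by (induction j arbitrary: \<kappa> f) (auto intro: bnd)
qed

lemma geom_bounded_add:
  assumes "geom_bounded U \<kappa> f" "geom_bounded U \<kappa> g"
  shows "geom_bounded U \<kappa> (\<lambda>l z. f l z + g l z)"
proof -
  obtain A where A: "A \<ge> 1" "\<And>l z. z \<in> U \<Longrightarrow> \<bar>f l z\<bar> \<le> A ^ Suc l * norm z powi \<kappa> l"
    using assms(1) by (rule geom_boundedE) blast
  obtain B where B: "B \<ge> 1" "\<And>l z. z \<in> U \<Longrightarrow> \<bar>g l z\<bar> \<le> B ^ Suc l * norm z powi \<kappa> l"
    using assms(2) by (rule geom_boundedE) blast
  have AB: "A ^ Suc l + B ^ Suc l \<le> (A + B) ^ Suc l" for l
  proof (induction l)
    case (Suc l)
    have "A ^ Suc (Suc l) + B ^ Suc (Suc l) \<le> (A + B) * (A ^ Suc l + B ^ Suc l)"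
      using A(1) B(1) by (simp add: algebra_simps)
    also have "\<dots> \<le> (A + B) * (A + B) ^ Suc l"
      using Suc.IH A(1) B(1) by (intro mult_left_mono) auto
    finally show ?case by simp
  qed simp
  show ?thesis
  proof (rule geom_boundedI)
    fix l z assume z: "z \<in> U"
    have "\<bar>f l z + g l z\<bar> \<le> (A ^ Suc l + B ^ Suc l) * norm z powi \<kappa> l"
      using A(2)[OF z, of l] B(2)[OF z, of l] unfolding distrib_right by linarith
    also have "\<dots> \<le> (A + B) ^ Suc l * norm z powi \<kappa> l"
      using AB by (intro mult_right_mono) auto
    finally show "\<bar>f l z + g l z\<bar> \<le> (A + B) ^ Suc l * norm z powi \<kappa> l" .
  qed (use A B in simp)
qed

lemma geom_bounded_mult:
  assumes "0 \<notin> U" "geom_bounded U \<kappa> f" "geom_bounded U \<kappa>' g"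
  shows "geom_bounded U (\<lambda>l. \<kappa> l + \<kappa>' l) (\<lambda>l z. f l z * g l z)"
proof -
  obtain A where A: "A \<ge> 1" "\<And>l z. z \<in> U \<Longrightarrow> \<bar>f l z\<bar> \<le> A ^ Suc l * norm z powi \<kappa> l"
    using assms(2) by (rule geom_boundedE) blast
  obtain B where B: "B \<ge> 1" "\<And>l z. z \<in> U \<Longrightarrow> \<bar>g l z\<bar> \<le> B ^ Suc l * norm z powi \<kappa>' l"
    using assms(3) by (rule geom_boundedE) blast
  show ?thesis
  proof (rule geom_boundedI)
    fix l z assume z: "z \<in> U"
    then have nz: "z \<noteq> 0" using assms(1) by auto
    have "\<bar>f l z * g l z\<bar> \<le> (A ^ Suc l * norm z powi \<kappa> l) * (B ^ Suc l * norm z powi \<kappa>' l)"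
      unfolding abs_mult using A(1) by (intro mult_mono A(2) B(2) z) auto
    also have "\<dots> = (A * B) ^ Suc l * norm z powi (\<kappa> l + \<kappa>' l)"
      using nz by (simp only: power_int_add power_mult_distrib norm_eq_zero simp_thms) (simp only: mult_ac)
    finally show "\<bar>f l z * g l z\<bar> \<le> (A * B) ^ Suc l * norm z powi (\<kappa> l + \<kappa>' l)" .
  qed (use A B mult_mono[of 1 A 1 B] in simp)
qed

lemma partial_add:
  assumes "pdiff i f z" "pdiff i g z"
  shows "pdiff i (\<lambda>z. f z + g z) z" "partial i (\<lambda>z. f z + g z) z = partial i f z + partial i g z"
  using partialI[OF DERIV_add[OF assms[unfolded pdiff_iff]]] by auto

lemma partial_mult:
  assumes "pdiff i f z" "pdiff i g z"
  shows "pdiff i (\<lambda>z. f z * g z) z"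
    "partial i (\<lambda>z. f z * g z) z = partial i f z * g z + f z * partial i g z"
  using partialI[OF DERIV_mult'[OF assms[unfolded pdiff_iff]]] by (auto simp: algebra_simps)

lemma partial_inverse:
  assumes "pdiff i f z" "f z \<noteq> 0"
  shows "pdiff i (\<lambda>z. inverse (f z)) z"
    "partial i (\<lambda>z. inverse (f z)) z = (- 1) * (partial i f z * (inverse (f z) * inverse (f z)))"
proof -
  have "((\<lambda>t. inverse (f (z + t *\<^sub>R axis i 1))) has_real_derivative
      (- 1) * (partial i f z * (inverse (f z) * inverse (f z)))) (at 0)"
    using DERIV_inverse'[OF assms(1)[unfolded pdiff_iff]] assms(2) by (simp add: mult_ac)
  from partialI[OF this] show "pdiff i (\<lambda>z. inverse (f z)) z"
    "partial i (\<lambda>z. inverse (f z)) z = (- 1) * (partial i f z * (inverse (f z) * inverse (f z)))"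
    by auto
qed

lemma symbol_family_add:
  assumes U: "open U"
  shows "symbol_family j U \<kappa> f \<Longrightarrow> symbol_family j U \<kappa> g \<Longrightarrow>
     symbol_family j U \<kappa> (\<lambda>l z. f l z + g l z)"
proof (induction j arbitrary: \<kappa> f g)
  case 0
  then show ?case by (auto intro: continuous_intros geom_bounded_add)
next
  case (Suc j)
  have "symbol_family j U (\<lambda>l. \<kappa> l - 1) (\<lambda>l. partial i (\<lambda>z. f l z + g l z))" for i
  proof -
    have "symbol_family j U (\<lambda>l. \<kappa> l - 1) (\<lambda>l z. partial i (f l) z + partial i (g l) z)"
      using Suc.prems by (intro Suc.IH) auto
    then show ?thesis
      using Suc.prems by (subst symbol_family_cong[OF U]) (auto simp: partial_add)
  qed
  then show ?case
    using Suc.prems by (auto intro!: continuous_intros geom_bounded_add partial_add)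
qed

lemma symbol_family_mult:
  assumes U: "open U" "0 \<notin> U"
  shows "symbol_family j U \<kappa> f \<Longrightarrow> symbol_family j U \<kappa>' g \<Longrightarrow>
     symbol_family j U (\<lambda>l. \<kappa> l + \<kappa>' l) (\<lambda>l z. f l z * g l z)"
proof (induction j arbitrary: \<kappa> \<kappa>' f g)
  case 0
  then show ?case using geom_bounded_mult[OF U(2)] by (auto intro: continuous_intros)
next
  case (Suc j)
  have "symbol_family j U (\<lambda>l. \<kappa> l + \<kappa>' l - 1) (\<lambda>l. partial i (\<lambda>z. f l z * g l z))" for i
  proof -
    have "symbol_family j U (\<lambda>l. (\<kappa> l - 1) + \<kappa>' l) (\<lambda>l z. partial i (f l) z * g l z)"
         "symbol_family j U (\<lambda>l. \<kappa> l + (\<kappa>' l - 1)) (\<lambda>l z. f l z * partial i (g l) z)"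
      using Suc.prems symbol_family_SucD by (auto intro!: Suc.IH simp del: symbol_family.simps(1))
    then have "symbol_family j U (\<lambda>l. \<kappa> l + \<kappa>' l - 1)
        (\<lambda>l z. partial i (f l) z * g l z + f l z * partial i (g l) z)"
      by (intro symbol_family_add U) (simp_all add: algebra_simps)
    then show ?thesis
      using Suc.prems by (subst symbol_family_cong[OF U(1)]) (auto simp: partial_mult)
  qed
  then show ?case
    using Suc.prems geom_bounded_mult[OF U(2)]
    by (auto intro!: continuous_intros partial_mult)
qed

lemma symbol_family_zero: "symbol_family j U \<kappa> (\<lambda>l z. 0)"
proof (induction j arbitrary: \<kappa>)
  case 0
  show ?case by (auto intro!: geom_boundedI[of 1])
next
  case (Suc j)
  have "pdiff i (\<lambda>z. 0) z" "partial i (\<lambda>z. 0) = (\<lambda>z. 0)" for i z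
    using partialI[OF DERIV_const] by (auto simp: fun_eq_iff)
  with Suc show ?case by (auto intro!: geom_boundedI[of 1])
qed

lemma symbol_family_const:
  assumes "A \<ge> 1" "\<And>l. \<bar>a l\<bar> \<le> A ^ Suc l"
  shows "symbol_family j U (\<lambda>l. 0) (\<lambda>l z. a l)"
proof -
  have b: "geom_bounded U (\<lambda>l. 0) (\<lambda>l z. a l)"
    using assms by (auto intro!: geom_boundedI[of A])
  have "pdiff i (\<lambda>z. a l) z" "partial i (\<lambda>z. a l) = (\<lambda>z. 0)" for i l z
    using partialI[OF DERIV_const] by (auto simp: fun_eq_iff)
  with b show ?thesis by (cases j) (auto simp: symbol_family_zero)
qed

lemma symbol_family_cmult:
  assumes U: "open U" "0 \<notin> U" and "A \<ge> 1" "\<And>l. \<bar>a l\<bar> \<le> A ^ Suc l" "symbol_family j U \<kappa> f"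
  shows "symbol_family j U \<kappa> (\<lambda>l z. a l * f l z)"
  using symbol_family_mult[OF U symbol_family_const[OF assms(3,4)] assms(5)] by simp

text \<open>
  The derivative of \<open>1 / f\<close> is \<open>- f' / f\<^sup>2\<close>, which involves \<open>1 / f\<close> only with one derivative less.
  So only the estimate of \<open>1 / f\<close> itself has to be assumed, in the form of a lower bound for \<open>f\<close>.
\<close>

lemma symbol_family_inverse:
  assumes U: "open U" "0 \<notin> U" and A: "A \<ge> 1"
    and lower: "\<And>l z. z \<in> U \<Longrightarrow> norm z powi \<kappa> l \<le> A ^ Suc l * \<bar>f l z\<bar>"
  shows "symbol_family j U \<kappa> f \<Longrightarrow> symbol_family j U (\<lambda>l. - \<kappa> l) (\<lambda>l z. inverse (f l z))"
proof (induction j)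
  case 0
  have nz: "f l z \<noteq> 0" if "z \<in> U" for l z
  proof -
    have "norm z powi \<kappa> l > 0" using that U by (intro zero_less_power_int) auto
    then show ?thesis using lower[OF that, of l] by auto
  qed
  have "\<bar>inverse (f l z)\<bar> \<le> A ^ Suc l * norm z powi (- \<kappa> l)" if "z \<in> U" for l z
  proof -
    have "norm z powi \<kappa> l > 0" using that U by (intro zero_less_power_int) auto
    then show ?thesis
      using lower[OF that, of l] nz[OF that, of l]
      by (simp add: power_int_minus field_simps del: power_Suc)
  qed
  then have "geom_bounded U (\<lambda>l. - \<kappa> l) (\<lambda>l z. inverse (f l z))"
    using A by (intro geom_boundedI)
  then show ?case using 0 nz by (auto intro!: continuous_intros)
next
  case (Suc j)
  note IH = Suc.IH[OF symbol_family_SucD[OF Suc.prems]]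
  have nz: "f l z \<noteq> 0" if "z \<in> U" for l z
  proof -
    have "norm z powi \<kappa> l > 0" using that U by (intro zero_less_power_int) auto
    then show ?thesis using lower[OF that, of l] by auto
  qed
  have "symbol_family j U (\<lambda>l. - \<kappa> l - 1) (\<lambda>l. partial i (\<lambda>z. inverse (f l z)))" for i
  proof -
    have "symbol_family j U (\<lambda>l. (\<kappa> l - 1) + (- \<kappa> l + - \<kappa> l))
       (\<lambda>l z. partial i (f l) z * (inverse (f l z) * inverse (f l z)))"
      using Suc.prems by (intro symbol_family_mult U IH) auto
    then have "symbol_family j U (\<lambda>l. (\<kappa> l - 1) + (- \<kappa> l + - \<kappa> l))
       (\<lambda>l z. (- 1) * (partial i (f l) z * (inverse (f l z) * inverse (f l z))))"
      by (intro symbol_family_cmult[of _ 1] U) auto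
    moreover have "(\<lambda>l. (\<kappa> l - 1) + (- \<kappa> l + - \<kappa> l)) = (\<lambda>l. - \<kappa> l - 1)" by auto
    ultimately show ?thesis
      using Suc.prems nz by (subst symbol_family_cong[OF U(1)]) (auto simp: partial_inverse)
  qed
  then show ?case
    using Suc.prems nz symbol_family_0[OF IH] by (auto intro!: partial_inverse)
qed

text \<open>
  The hypotheses pass to the partial derivatives of the polynomials, so the size estimate, which
  follows from homogeneity, is all there is to show.
\<close>

lemma symbol_family_eval2:
  fixes d :: "nat \<Rightarrow> int"
  assumes deg: "\<And>l. d l \<le> int (B * Suc l)"
  shows "(\<And>l. homogeneous2 (d l) (P l)) \<Longrightarrow> unit_ball_bounded P \<Longrightarrow>
     symbol_family j (- {0}) d (\<lambda>l. eval2 (P l))"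
  using deg
proof (induction j arbitrary: P d)
  case (0 P d)
  then obtain A where A: "A \<ge> 1" "\<And>l z. norm z \<le> 1 \<Longrightarrow> \<bar>eval2 (P l) z\<bar> \<le> A ^ Suc l"
    unfolding unit_ball_bounded_def by blast
  have "\<bar>eval2 (P l) z\<bar> \<le> A ^ Suc l * norm z powi d l" if "z \<noteq> 0" for l z
  proof (cases "d l < 0")
    case True
    then have "P l = 0" using 0(1) homogeneous2_negative by blast
    then show ?thesis using A(1) by simp
  next
    case False
    then have k: "d l = int (nat (d l))" by simp
    have "homogeneous2 (int (nat (d l))) (P l)" using 0(1)[of l] k by simp
    from eval2_scale[OF this, of "norm z" "(1 / norm z) *\<^sub>R z"]
    have "eval2 (P l) z = norm z ^ nat (d l) * eval2 (P l) ((1 / norm z) *\<^sub>R z)"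
      using that by simp
    moreover have "\<bar>eval2 (P l) ((1 / norm z) *\<^sub>R z)\<bar> \<le> A ^ Suc l"
      using that by (intro A) simp
    ultimately have "\<bar>eval2 (P l) z\<bar> \<le> norm z ^ nat (d l) * A ^ Suc l"
      by (simp add: abs_mult mult_left_mono del: power_Suc)
    then show ?thesis by (subst k) (simp add: mult.commute del: power_Suc int_nat_eq)
  qed
  then show ?case
    using A(1) by (auto intro!: continuous_on_eval2 geom_boundedI[of A] simp del: power_Suc)
next
  case (Suc j P d)
  have p: "pdiff i (eval2 (P l)) z" "partial i (eval2 (P l)) = eval2 (pderiv2 i (P l))" for i l z
    using partialI[OF eval2_has_partial] by auto
  have "symbol_family j (- {0}) (\<lambda>l. d l - 1) (\<lambda>l. eval2 (pderiv2 i (P l)))" for i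
  proof (rule Suc.IH)
    show "homogeneous2 (d l - 1) (pderiv2 i (P l))" for l
      using Suc.prems(1) by (rule homogeneous2_pderiv2)
    show "unit_ball_bounded (\<lambda>l. pderiv2 i (P l))"
      using Suc.prems by (intro unit_ball_bounded_pderiv2)
    show "d l - 1 \<le> int (B * Suc l)" for l
      using Suc.prems(3)[of l] by linarith
  qed
  then show ?case
    using symbol_family_0[OF symbol_family_mono[OF Suc.IH[OF Suc.prems], of 0]]
    by (simp add: p)
qed

lemma power_int_comparable:
  fixes x y A :: real
  assumes "0 < x" "0 < y" "1 \<le> A" "x \<le> A * y" "y \<le> A * x"
  shows "x powi e \<le> A ^ nat \<bar>e\<bar> * y powi e"
proof (cases "e \<ge> 0")
  case True
  then obtain k where "e = int k" by (metis nonneg_int_cases)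
  moreover have "x ^ k \<le> (A * y) ^ k" using assms by (intro power_mono) auto
  ultimately show ?thesis by (simp add: power_mult_distrib)
next
  case False
  define k where "k = nat (- e)"
  have e: "e = - int k" using False by (simp add: k_def)
  have "y ^ k \<le> (A * x) ^ k" using assms by (intro power_mono) auto
  then have "inverse (x ^ k) \<le> A ^ k * inverse (y ^ k)"
    using assms by (simp add: field_simps power_mult_distrib)
  then show ?thesis by (simp add: e power_int_minus)
qed

text \<open>
  A continuous function without zeros on the unit circle is bounded away from 0 and infinity there,
  by compactness.
\<close>

lemma homogeneous_comparable:
  fixes f :: "real ^ 2 \<Rightarrow> real"
  assumes cont: "continuous_on (sphere 0 1) f"
    and nz: "\<And>z. norm z = 1 \<Longrightarrow> f z \<noteq> 0"
    and scale: "\<And>t z. t > 0 \<Longrightarrow> f (t *\<^sub>R z) = t powi k * f z"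
  obtains A where "A \<ge> 1" "\<And>z. z \<noteq> 0 \<Longrightarrow> norm z powi k \<le> A * \<bar>f z\<bar>"
    "\<And>z. z \<noteq> 0 \<Longrightarrow> \<bar>f z\<bar> \<le> A * norm z powi k"
proof -
  let ?S = "sphere (0 :: real ^ 2) 1"
  have comp: "compact ?S" by simp
  have "bounded ((\<lambda>z. f z) ` ?S)" "bounded ((\<lambda>z. inverse (f z)) ` ?S)"
    using cont nz by (auto intro!: compact_imp_bounded compact_continuous_image comp continuous_intros)
  then obtain B C where B: "\<forall>z\<in>?S. norm (f z) \<le> B" and C: "\<forall>z\<in>?S. norm (inverse (f z)) \<le> C"
    unfolding bounded_iff by auto
  define A where "A = max 1 (max B C)"
  have A: "A \<ge> 1" "B \<le> A" "C \<le> A" by (auto simp: A_def)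
  have f: "f z = norm z powi k * f (sgn z)" if "z \<noteq> 0" for z
    using scale[of "norm z" "sgn z"] that by (simp add: sgn_div_norm)
  have sgn: "sgn z \<in> ?S" if "z \<noteq> 0" for z :: "real ^ 2" using that by (simp add: norm_sgn)
  show thesis
  proof (rule that[OF A(1)])
    fix z :: "real ^ 2" assume z: "z \<noteq> 0"
    have "\<bar>f (sgn z)\<bar> \<le> A" using B sgn[OF z] A by force
    then show "\<bar>f z\<bar> \<le> A * norm z powi k"
      using z by (subst f[OF z]) (simp add: abs_mult power_int_abs mult.commute mult_left_mono)
    have "inverse \<bar>f (sgn z)\<bar> \<le> A" using C sgn[OF z] A by force
    then have "1 \<le> A * \<bar>f (sgn z)\<bar>" using nz[of "sgn z"] sgn[OF z] by (simp add: field_simps)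
    then show "norm z powi k \<le> A * \<bar>f z\<bar>"
      using z mult_left_mono[of 1 "A * \<bar>f (sgn z)\<bar>" "norm z powi k"]
      by (subst f[OF z]) (simp add: abs_mult power_int_abs mult_ac)
  qed
qed

section \<open>Powers of \<open>R\<close>\<close>

definition R_squared :: "real \<Rightarrow> real \<Rightarrow> real \<Rightarrow> real poly poly" where
  "R_squared a b c = [:[:0, 0, a:], [:0, b:], [:c:]:]"

lemma eval2_R_squared: "eval2 (R_squared a b c) z = a * (z $ 1)\<^sup>2 + b * z $ 1 * z $ 2 + c * (z $ 2)\<^sup>2"
  by (simp add: R_squared_def algebra_simps power2_eq_square)

lemma homogeneous2_R_squared: "homogeneous2 2 (R_squared a b c)"
  by (auto simp: homogeneous2_def R_squared_def coeff_pCons split: nat.splits)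

lemma R_eq_sqrt: "R a b c z = sqrt (eval2 (R_squared a b c) z)"
  by (simp add: R_def eval2_R_squared)

text \<open>
  Completing the square after multiplication by \<open>4 * a\<close>.
\<close>

lemma positive_definite:
  fixes z :: "real ^ 2"
  assumes "a > 0" "4 * a * c - b\<^sup>2 > 0" "z \<noteq> 0"
  shows "eval2 (R_squared a b c) z > 0"
proof -
  have "4 * a * eval2 (R_squared a b c) z
      = (2 * a * z $ 1 + b * z $ 2)\<^sup>2 + (4 * a * c - b\<^sup>2) * (z $ 2)\<^sup>2"
    by (simp add: eval2_R_squared algebra_simps power2_eq_square)
  moreover have "\<dots> > 0"
  proof (cases "z $ 2 = 0")
    case True
    then have "z $ 1 \<noteq> 0" using assms(3) by (auto simp: vec_eq_iff forall_2)
    then show ?thesis using True assms(1) by simp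
  next
    case False
    then show ?thesis using assms(2) by (intro add_nonneg_pos mult_pos_pos) auto
  qed
  ultimately have "4 * a * eval2 (R_squared a b c) z > 0" by (simp only:)
  then show ?thesis using assms(1) by (simp add: zero_less_mult_iff)
qed

lemma continuous_on_R [continuous_intros]: "continuous_on S (R a b c)"
  unfolding R_eq_sqrt by (intro continuous_intros)

lemma R_scale: "t > 0 \<Longrightarrow> R a b c (t *\<^sub>R z) = t * R a b c z"
  using eval2_scale[of 2 "R_squared a b c" t z] homogeneous2_R_squared[of a b c]
  by (simp add: R_eq_sqrt real_sqrt_mult)

locale elliptic_form =
  fixes a b c :: real
  assumes a: "a > 0" and disc: "4 * a * c - b\<^sup>2 > 0"
begin

lemma R_pos: "z \<noteq> 0 \<Longrightarrow> R a b c z > 0"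
  using positive_definite[OF a disc] by (simp add: R_eq_sqrt)

lemma R_comparable:
  obtains A where "A \<ge> 1" "\<And>z. z \<noteq> 0 \<Longrightarrow> norm z \<le> A * R a b c z"
    "\<And>z. z \<noteq> 0 \<Longrightarrow> R a b c z \<le> A * norm z"
proof (rule homogeneous_comparable[of "R a b c" 1])
  show "R a b c z \<noteq> 0" if "norm z = 1" for z
    using R_pos[of z] that by force
  fix A assume A: "A \<ge> 1" "\<And>z. z \<noteq> 0 \<Longrightarrow> norm z powi 1 \<le> A * \<bar>R a b c z\<bar>"
    "\<And>z. z \<noteq> 0 \<Longrightarrow> \<bar>R a b c z\<bar> \<le> A * norm z powi 1"
  show thesis
    using A(2,3) R_pos by (intro that[OF A(1)]) (simp_all add: abs_of_pos)
qed (auto simp: R_scale intro!: continuous_intros)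

text \<open>
  For the quadratic form \<open>Q = R\<^sup>2\<close> the chain rule gives
  \<open>partial i (R powi e) = (e / 2) * R powi e * partial i Q / Q\<close>. So the derivative is the family
  itself, with one derivative less to control, times factors of total order -1.
\<close>

lemma symbol_family_R_power:
  assumes e: "\<And>l. nat \<bar>e l\<bar> \<le> B * Suc l"
  shows "symbol_family j (- {0}) e (\<lambda>l z. R a b c z powi e l)"
proof (induction j)
  case 0
  obtain A where A: "A \<ge> 1" "\<And>z. z \<noteq> 0 \<Longrightarrow> norm z \<le> A * R a b c z"
    "\<And>z. z \<noteq> 0 \<Longrightarrow> R a b c z \<le> A * norm z"
    by (rule R_comparable) blast
  have "\<bar>R a b c z powi e l\<bar> \<le> (A ^ B) ^ Suc l * norm z powi e l" if z: "z \<noteq> 0" for l z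
  proof -
    have "\<bar>R a b c z powi e l\<bar> = R a b c z powi e l" using R_pos[OF z] by simp
    also have "\<dots> \<le> A ^ nat \<bar>e l\<bar> * norm z powi e l"
      using z A R_pos by (intro power_int_comparable) auto
    also have "\<dots> \<le> (A ^ B) ^ Suc l * norm z powi e l"
      using power_le_geometric[OF A(1) e[of l]] by (intro mult_right_mono) auto
    finally show ?thesis .
  qed
  moreover have "A ^ B \<ge> 1" using A(1) by (rule one_le_power)
  moreover have "R a b c z \<noteq> 0" if "z \<noteq> 0" for z using R_pos[OF that] by simp
  ultimately show ?case
    by (auto intro!: continuous_intros geom_boundedI[of "A ^ B"] simp del: power_Suc)
next
  case (Suc j)
  let ?Q = "eval2 (R_squared a b c)"
  have U: "open (- {0 :: real ^ 2})" "(0 :: real ^ 2) \<notin> - {0}" by auto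
  have Rnz: "R a b c z \<noteq> 0" if "z \<noteq> 0" for z using R_pos[OF that] by simp
  have p: "pdiff i (\<lambda>z. R a b c z powi e l) z"
    "partial i (\<lambda>z. R a b c z powi e l) z
       = (of_int (e l) / 2) * (R a b c z powi e l * (partial i ?Q z * inverse (?Q z)))"
    if z: "z \<noteq> 0" for i l z
  proof -
    have Q: "?Q z > 0" using positive_definite[OF a disc z] .
    have dQ: "((\<lambda>t. ?Q (z + t *\<^sub>R axis i 1)) has_real_derivative partial i ?Q z) (at 0)"
      using partialI[OF eval2_has_partial] pdiff_iff by blast
    have "((\<lambda>t. sqrt (?Q (z + t *\<^sub>R axis i 1))) has_real_derivative
       inverse (sqrt (?Q z)) / 2 * partial i ?Q z) (at 0)"
      by (rule DERIV_chain2[OF _ dQ]) (use DERIV_real_sqrt[OF Q] in simp)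
    from DERIV_power_int[OF this, of "e l"] Q
    have "((\<lambda>t. R a b c (z + t *\<^sub>R axis i 1) powi e l) has_real_derivative
       of_int (e l) * R a b c z powi (e l - 1) * (inverse (R a b c z) / 2 * partial i ?Q z)) (at 0)"
      by (simp add: R_eq_sqrt mult_ac)
    also have "of_int (e l) * R a b c z powi (e l - 1) * (inverse (R a b c z) / 2 * partial i ?Q z)
       = (of_int (e l) / 2) * (R a b c z powi e l * (partial i ?Q z * inverse (?Q z)))"
    proof -
      have "inverse (?Q z) = inverse (R a b c z) * inverse (R a b c z)"
        using Q by (simp add: R_eq_sqrt flip: inverse_mult_distrib)
      moreover have "R a b c z powi (e l - 1) = R a b c z powi e l * inverse (R a b c z)"
        using Rnz[OF z] by (simp add: power_int_diff divide_inverse)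
      ultimately show ?thesis by simp
    qed
    finally have d: "((\<lambda>t. R a b c (z + t *\<^sub>R axis i 1) powi e l) has_real_derivative
       (of_int (e l) / 2) * (R a b c z powi e l * (partial i ?Q z * inverse (?Q z)))) (at 0)" .
    from partialI[OF this] show "pdiff i (\<lambda>z. R a b c z powi e l) z"
    "partial i (\<lambda>z. R a b c z powi e l) z
       = (of_int (e l) / 2) * (R a b c z powi e l * (partial i ?Q z * inverse (?Q z)))"
      by auto
  qed
  have symQ: "symbol_family j' (- {0}) (\<lambda>l. 2) (\<lambda>l. ?Q)" for j'
  proof (rule symbol_family_eval2[of _ 2])
    have "bounded (?Q ` cball 0 1)"
      by (intro compact_imp_bounded compact_continuous_image continuous_intros compact_cball)
    then obtain M where "\<forall>y\<in>?Q ` cball 0 1. norm y \<le> M"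
      unfolding bounded_iff by blast
    then have M: "\<bar>?Q z\<bar> \<le> M" if "norm z \<le> 1" for z
      using that by simp
    have "\<bar>?Q z\<bar> \<le> max 1 M ^ Suc l" if "norm z \<le> 1" for l z
      using M[OF that] power_increasing[of 1 "Suc l" "max 1 M"] by simp
    then show "unit_ball_bounded (\<lambda>l. R_squared a b c)"
      unfolding unit_ball_bounded_def by (intro exI[of _ "max 1 M"]) auto
  qed (auto simp: homogeneous2_R_squared)
  have symdQ: "symbol_family j (- {0}) (\<lambda>l. 1) (\<lambda>l. partial i ?Q)" for i
    using symQ[of "Suc j"] by simp
  obtain A where A: "A \<ge> 1" "\<And>z. z \<noteq> 0 \<Longrightarrow> norm z \<le> A * R a b c z"
    by (rule R_comparable) blast
  have symQinv: "symbol_family j (- {0}) (\<lambda>l. - 2) (\<lambda>l z. inverse (?Q z))"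
  proof (rule symbol_family_inverse[OF U _ _ symQ])
    show "A\<^sup>2 \<ge> 1" using A(1) by simp
    fix l :: nat and z :: "real ^ 2" assume "z \<in> - {0}"
    then have z: "z \<noteq> 0" by simp
    have "(norm z)\<^sup>2 \<le> (A * R a b c z)\<^sup>2" using A(2)[OF z] by (intro power_mono) auto
    also have "\<dots> = (A\<^sup>2) ^ 1 * \<bar>?Q z\<bar>"
      using positive_definite[OF a disc z] by (simp add: R_eq_sqrt power_mult_distrib)
    also have "\<dots> \<le> (A\<^sup>2) ^ Suc l * \<bar>?Q z\<bar>"
      using A(1) by (intro mult_right_mono power_increasing) auto
    finally show "norm z powi 2 \<le> (A\<^sup>2) ^ Suc l * \<bar>?Q z\<bar>" by simp
  qed
  have "symbol_family j (- {0}) (\<lambda>l. e l - 1) (\<lambda>l. partial i (\<lambda>z. R a b c z powi e l))" for i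
  proof -
    have "symbol_family j (- {0}) (\<lambda>l. e l + (1 + - 2))
       (\<lambda>l z. R a b c z powi e l * (partial i ?Q z * inverse (?Q z)))"
      by (intro symbol_family_mult U Suc.IH symdQ symQinv)
    then have "symbol_family j (- {0}) (\<lambda>l. e l + (1 + - 2))
       (\<lambda>l z. (of_int (e l) / 2) * (R a b c z powi e l * (partial i ?Q z * inverse (?Q z))))"
    proof (rule symbol_family_cmult[OF U, rotated 2])
      \<comment> \<open>the factor \<open>e l / 2\<close> grows linearly in \<open>l\<close>, in particular at most geometrically\<close>
      show "\<bar>of_int (e l) / 2\<bar> \<le> ((2::real) ^ B) ^ Suc l" for l
      proof -
        have "\<bar>of_int (e l) / 2 :: real\<bar> \<le> real (nat \<bar>e l\<bar>)" by simp
        also have "\<dots> \<le> real (2 ^ nat \<bar>e l\<bar>)"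
          by (intro of_nat_mono less_imp_le less_exp)
        also have "\<dots> \<le> (2 ^ B) ^ Suc l"
          using power_le_geometric[of "2 :: real", OF _ e[of l]] by simp
        finally show ?thesis .
      qed
    qed simp
    then show ?thesis
      by (subst symbol_family_cong[OF U(1)]) (auto simp: p)
  qed
  then show ?case
    using symbol_family_0[OF Suc.IH] by (auto simp: p)
qed

end

section \<open>Summing a symbol family\<close>

lemma symbol_family_weaken:
  assumes U: "U \<subseteq> cball 0 1 - {0}"
  shows "(\<And>l. \<kappa>' l \<le> \<kappa> l) \<Longrightarrow> symbol_family j U \<kappa> f \<Longrightarrow> symbol_family j U \<kappa>' f"
proof (induction j arbitrary: \<kappa> \<kappa>' f)
  case (0 \<kappa> \<kappa>' f)
  have "geom_bounded U \<kappa>' f"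
  proof -
    obtain A where A: "A \<ge> 1" "\<And>l z. z \<in> U \<Longrightarrow> \<bar>f l z\<bar> \<le> A ^ Suc l * norm z powi \<kappa> l"
      using 0(2) by (auto elim: geom_boundedE)
    have "\<bar>f l z\<bar> \<le> A ^ Suc l * norm z powi \<kappa>' l" if z: "z \<in> U" for l z
    proof -
      have "norm z powi \<kappa> l \<le> norm z powi \<kappa>' l"
        using z U 0(1)[of l] by (intro power_int_decreasing) auto
      then show ?thesis
        using A(2)[OF z, of l] A(1) mult_left_mono[of _ _ "A ^ Suc l"]
        by (smt (verit) zero_le_power)
    qed
    with A(1) show ?thesis by (rule geom_boundedI)
  qed
  with 0 show ?case by simp
next
  case (Suc j)
  from Suc.IH[OF _ symbol_family_mono[OF Suc.prems(2), of j]] Suc.prems(1)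
  have "symbol_family j U \<kappa>' f" by simp
  moreover have "symbol_family j U (\<lambda>l. \<kappa>' l - 1) (\<lambda>l. partial i (f l))" for i
  proof (rule Suc.IH[of _ "\<lambda>l. \<kappa> l - 1"])
    show "\<kappa>' l - 1 \<le> \<kappa> l - 1" for l
      using Suc.prems(1)[of l] by linarith
  qed (use Suc.prems(2) in simp)
  ultimately show ?case using Suc.prems symbol_family_0 by auto
qed

lemma symbol_family_finite_sum:
  assumes U: "open U" "U \<subseteq> cball 0 1 - {0}"
    and f: "symbol_family j U (\<lambda>l. int l + k) f"
  shows "symbol_family j U (\<lambda>_. k) (\<lambda>_ z. \<Sum>l<N. f l z)"
proof (induction N)
  case 0
  show ?case by (simp add: symbol_family_zero)
next
  case (Suc N)
  have "symbol_family j U (\<lambda>_. int N + k) (\<lambda>_. f N)"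
    using symbol_family_reindex[of "\<lambda>_. N" N, OF _ f] by simp
  then have "symbol_family j U (\<lambda>_. k) (\<lambda>_. f N)"
    by (rule symbol_family_weaken[OF U(2), rotated]) simp
  from symbol_family_add[OF U(1) Suc.IH this] show ?case by simp
qed

text \<open>
  Once \<open>norm z\<close> is below \<open>1 / (2 * A)\<close>, each factor \<open>norm z\<close> outweighs a factor \<open>A\<close> twice.
\<close>

lemma geom_bounded_majorant:
  assumes "0 \<notin> U" and gb: "geom_bounded U (\<lambda>l. int l + k) f"
  shows "\<exists>\<delta>>0. \<exists>A\<ge>1. \<forall>l. \<forall>z\<in>U \<inter> ball 0 \<delta>. \<bar>f l z\<bar> \<le> A * norm z powi k * (1/2) ^ l"
proof -
  obtain A where A: "A \<ge> 1" "\<And>l z. z \<in> U \<Longrightarrow> \<bar>f l z\<bar> \<le> A ^ Suc l * norm z powi (int l + k)"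
    using gb by (auto elim: geom_boundedE)
  have "\<bar>f l z\<bar> \<le> A * norm z powi k * (1/2) ^ l" if z: "z \<in> U \<inter> ball 0 (1 / (2 * A))" for l z
  proof -
    have "z \<noteq> 0" using z \<open>0 \<notin> U\<close> by auto
    have "A * norm z \<le> 1 / 2" using z A(1) by (simp add: field_simps)
    then have "(A * norm z) ^ l \<le> (1/2) ^ l" using A(1) by (intro power_mono) auto
    then have "A * norm z powi k * (A * norm z) ^ l \<le> A * norm z powi k * (1/2) ^ l"
      using A(1) by (intro mult_left_mono) auto
    moreover have "A ^ Suc l * norm z powi (int l + k) = A * norm z powi k * (A * norm z) ^ l"
      using \<open>z \<noteq> 0\<close> by (simp add: power_int_add power_mult_distrib)
    moreover have "\<bar>f l z\<bar> \<le> A ^ Suc l * norm z powi (int l + k)" using A(2) z by blast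
    ultimately show ?thesis by linarith
  qed
  moreover have "1 / (2 * A) > 0" using A(1) by simp
  ultimately show ?thesis using A(1) by blast
qed

text \<open>
  After division by \<open>norm z powi k\<close> the majorant no longer depends on \<open>z\<close>, so the series converges
  uniformly up to the puncture.
\<close>

lemma symbol_family_0_suminf:
  assumes V: "0 \<notin> V" and A: "A \<ge> 1"
    and bd: "\<And>l z. z \<in> V \<Longrightarrow> \<bar>f l z\<bar> \<le> A * norm z powi k * (1/2) ^ l"
    and cont: "\<And>l. continuous_on V (f l)"
  shows "symbol_family 0 V (\<lambda>_. k) (\<lambda>_ z. \<Sum>l. f l z)"
proof -
  define h where "h l z = norm z powi (- k) * f l z" for l z
  have nz: "norm z powi k > 0" if "z \<in> V" for z
    using that V by (intro zero_less_power_int) auto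
  have hb: "norm (h l z) \<le> A * (1/2) ^ l" if z: "z \<in> V" for l z
  proof -
    have "norm (h l z) = \<bar>f l z\<bar> / norm z powi k"
      using nz[OF z] by (simp add: h_def abs_mult power_int_minus divide_inverse)
    also have "\<dots> \<le> A * (1/2) ^ l"
      using bd[of z l] z V nz[OF z] by (simp add: pos_divide_le_eq subset_iff mult_ac)
    finally show ?thesis .
  qed
  have sm: "summable (\<lambda>l. A * (1/2 :: real) ^ l)" by (intro summable_mult summable_geometric) auto
  have "uniform_limit V (\<lambda>n z. \<Sum>i<n. h i z) (\<lambda>z. \<Sum>i. h i z) sequentially"
    using hb sm by (rule Weierstrass_m_test)
  then have ch: "continuous_on V (\<lambda>z. \<Sum>i. h i z)"
  proof (rule uniform_limit_theorem[rotated])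
    have "continuous_on V (h l)" for l
      unfolding h_def using V by (intro continuous_intros cont) auto
    then show "\<forall>\<^sub>F n in sequentially. continuous_on V (\<lambda>z. \<Sum>i<n. h i z)"
      by (intro always_eventually allI continuous_on_sum)
  qed simp
  have sh: "summable (\<lambda>l. h l z)" if "z \<in> V" for z
    by (rule summable_comparison_test'[where N = 0, OF sm]) (rule hb[OF that])
  have eq: "(\<Sum>l. f l z) = norm z powi k * (\<Sum>l. h l z)" if z: "z \<in> V" for z
  proof -
    have "f l z = norm z powi k * h l z" for l
      using less_imp_neq[OF nz[OF z]] by (simp add: h_def power_int_minus)
    then show ?thesis using suminf_mult[OF sh[OF z]] by simp
  qed
  have "continuous_on V (\<lambda>z. norm z powi k * (\<Sum>l. h l z))"
    using V by (intro continuous_intros ch) auto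
  then have "continuous_on V (\<lambda>z. \<Sum>l. f l z)"
    by (simp add: eq cong: continuous_on_cong)
  moreover have "\<bar>\<Sum>l. f l z\<bar> \<le> (2 * A) ^ Suc l * norm z powi k" if z: "z \<in> V" for z and l :: nat
  proof -
    have "norm (\<Sum>l. h l z) \<le> (\<Sum>l. A * (1/2) ^ l)"
      using sm hb[OF z] by (rule norm_suminf_le[rotated])
    also have "\<dots> = 2 * A" by (subst suminf_mult) (auto simp: suminf_geometric)
    also have "\<dots> \<le> (2 * A) ^ Suc l"
      using power_increasing[of 1 "Suc l" "2 * A"] A by simp
    finally have "norm z powi k * norm (\<Sum>l. h l z) \<le> norm z powi k * (2 * A) ^ Suc l"
      by (intro mult_left_mono) auto
    then show ?thesis using nz[OF z] by (simp add: eq[OF z] abs_mult mult.commute del: power_Suc)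
  qed
  ultimately show ?thesis
    using A by (auto intro!: geom_boundedI[of "2 * A"] simp del: power_Suc)
qed

text \<open>
  The series may be differentiated term by term, since the differentiated series is again of this
  kind. Each derivative has its own growth rate, so the radius shrinks with \<open>j\<close>. The conclusion is
  stated for all small open sets \<open>V\<close> because the radii found for the two partial derivatives have to
  be replaced by a common smaller one.
\<close>

lemma symbol_family_suminf:
  assumes U: "open U" "0 \<notin> U"
  shows "symbol_family j U (\<lambda>l. int l + k) f \<Longrightarrow>
    \<exists>\<delta>>0. \<forall>V. open V \<longrightarrow> V \<subseteq> U \<inter> ball 0 \<delta> \<longrightarrow>
      symbol_family j V (\<lambda>_. k) (\<lambda>_ z. \<Sum>l. f l z)"
proof (induction j arbitrary: k f)
  case (0 k f)
  then obtain \<delta> A where A: "\<delta> > 0" "A \<ge> 1"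
    "\<And>l z. z \<in> U \<inter> ball 0 \<delta> \<Longrightarrow> \<bar>f l z\<bar> \<le> A * norm z powi k * (1/2) ^ l"
    using geom_bounded_majorant[OF U(2), of k f] by auto
  have "symbol_family 0 V (\<lambda>_. k) (\<lambda>_ z. \<Sum>l. f l z)" if V: "V \<subseteq> U \<inter> ball 0 \<delta>" for V
  proof (rule symbol_family_0_suminf[OF _ A(2)])
    show "0 \<notin> V" using V U(2) by blast
    show "\<bar>f l z\<bar> \<le> A * norm z powi k * (1/2) ^ l" if "z \<in> V" for l z
      using A(3) that V by blast
    show "continuous_on V (f l)" for l
      using 0 V by (auto intro: continuous_on_subset)
  qed
  with A(1) show ?case by blast
next
  case (Suc j k f)
  obtain \<delta>0 A where 0: "\<delta>0 > 0" "A \<ge> 1"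
    "\<And>l z. z \<in> U \<inter> ball 0 \<delta>0 \<Longrightarrow> \<bar>f l z\<bar> \<le> A * norm z powi k * (1/2) ^ l"
    using geom_bounded_majorant[OF U(2), of k f] Suc.prems by auto
  have sp: "symbol_family j U (\<lambda>l. int l + (k - 1)) (\<lambda>l. partial i (f l))" for i
    using Suc.prems by (simp add: algebra_simps)
  have ex: "\<exists>\<delta>>0. \<exists>B. (\<forall>l. \<forall>z\<in>U \<inter> ball 0 \<delta>. \<bar>partial i (f l) z\<bar> \<le> B * norm z powi (k - 1) * (1/2) ^ l) \<and>
    (\<forall>V. open V \<longrightarrow> V \<subseteq> U \<inter> ball 0 \<delta> \<longrightarrow>
      symbol_family j V (\<lambda>_. k - 1) (\<lambda>_ z. \<Sum>l. partial i (f l) z))" for i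
  proof -
    obtain \<delta>1 where 1: "\<delta>1 > 0" "\<forall>V. open V \<longrightarrow> V \<subseteq> U \<inter> ball 0 \<delta>1 \<longrightarrow>
      symbol_family j V (\<lambda>_. k - 1) (\<lambda>_ z. \<Sum>l. partial i (f l) z)"
      using Suc.IH[OF sp[of i]] by blast
    obtain \<delta>2 B where 2: "\<delta>2 > 0" "\<forall>l. \<forall>z\<in>U \<inter> ball 0 \<delta>2. \<bar>partial i (f l) z\<bar> \<le> B * norm z powi (k - 1) * (1/2) ^ l"
      using geom_bounded_majorant[OF U(2), of "k - 1" "\<lambda>l. partial i (f l)"] symbol_family_0[OF sp[of i]] by blast
    have "U \<inter> ball 0 (min \<delta>1 \<delta>2) \<subseteq> U \<inter> ball 0 \<delta>1" "U \<inter> ball 0 (min \<delta>1 \<delta>2) \<subseteq> U \<inter> ball 0 \<delta>2"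
      by auto
    then have "\<forall>l. \<forall>z\<in>U \<inter> ball 0 (min \<delta>1 \<delta>2). \<bar>partial i (f l) z\<bar> \<le> B * norm z powi (k - 1) * (1/2) ^ l"
      "\<forall>V. open V \<longrightarrow> V \<subseteq> U \<inter> ball 0 (min \<delta>1 \<delta>2) \<longrightarrow>
        symbol_family j V (\<lambda>_. k - 1) (\<lambda>_ z. \<Sum>l. partial i (f l) z)"
      using 1(2) 2(2) by (blast, meson order_trans)
    moreover have "min \<delta>1 \<delta>2 > 0" using 1(1) 2(1) by simp
    ultimately show ?thesis by blast
  qed
  obtain \<eta> B where \<eta>: "\<And>i. \<eta> i > 0"
    and B: "\<And>i l z. z \<in> U \<inter> ball 0 (\<eta> i) \<Longrightarrow> \<bar>partial i (f l) z\<bar> \<le> B i * norm z powi (k - 1) * (1/2) ^ l"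
    and S: "\<And>i V. open V \<Longrightarrow> V \<subseteq> U \<inter> ball 0 (\<eta> i) \<Longrightarrow>
      symbol_family j V (\<lambda>_. k - 1) (\<lambda>_ z. \<Sum>l. partial i (f l) z)"
  proof -
    from ex have "\<forall>i. \<exists>\<delta> B. \<delta> > 0 \<and>
      (\<forall>l. \<forall>z\<in>U \<inter> ball 0 \<delta>. \<bar>partial i (f l) z\<bar> \<le> B * norm z powi (k - 1) * (1/2) ^ l) \<and>
      (\<forall>V. open V \<longrightarrow> V \<subseteq> U \<inter> ball 0 \<delta> \<longrightarrow>
        symbol_family j V (\<lambda>_. k - 1) (\<lambda>_ z. \<Sum>l. partial i (f l) z))"
      by blast
    then obtain \<eta> B where "\<forall>i. \<eta> i > 0 \<and>
      (\<forall>l. \<forall>z\<in>U \<inter> ball 0 (\<eta> i). \<bar>partial i (f l) z\<bar> \<le> B i * norm z powi (k - 1) * (1/2) ^ l) \<and>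
      (\<forall>V. open V \<longrightarrow> V \<subseteq> U \<inter> ball 0 (\<eta> i) \<longrightarrow>
        symbol_family j V (\<lambda>_. k - 1) (\<lambda>_ z. \<Sum>l. partial i (f l) z))"
      unfolding choice_iff by blast
    then show thesis by (intro that[of \<eta> B]) auto
  qed
  define \<delta> where "\<delta> = min \<delta>0 (min (\<eta> 1) (\<eta> 2))"
  have \<delta>: "\<delta> > 0" using 0 \<eta> by (simp add: \<delta>_def)
  have sub: "ball 0 \<delta> \<subseteq> ball 0 (\<eta> i)" for i
    using exhaust_2[of i] by (auto simp: \<delta>_def)
  have "symbol_family (Suc j) V (\<lambda>_. k) (\<lambda>_ z. \<Sum>l. f l z)"
    if V: "open V" "V \<subseteq> U \<inter> ball 0 \<delta>" for V
  proof -
    have VU: "V \<subseteq> U \<inter> ball 0 (\<eta> i)" for i using V sub by blast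
    have V0: "V \<subseteq> U \<inter> ball 0 \<delta>0" using V(2) by (auto simp: \<delta>_def)
    have d: "pdiff i (\<lambda>z. \<Sum>l. f l z) z" "partial i (\<lambda>z. \<Sum>l. f l z) z = (\<Sum>l. partial i (f l) z)"
      if z: "z \<in> V" for i z
    proof -
      obtain r where r: "r > 0" "cball z r \<subseteq> V"
        using V(1) z open_contains_cball by blast
      have inV: "z + t *\<^sub>R axis i 1 \<in> V" if "t \<in> cball 0 r" for t
        using that r(2) by (auto simp: subset_iff dist_norm)
      \<comment> \<open>away from 0 the factor \<open>norm y powi (k - 1)\<close> is bounded, so the differentiated series
        converges uniformly on the segment\<close>
      have "bounded ((\<lambda>y. norm y powi (k - 1)) ` cball z r)"
        using r(2) V U
        by (intro compact_imp_bounded compact_continuous_image continuous_intros compact_cball) auto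
      then obtain C where C: "\<And>y. y \<in> cball z r \<Longrightarrow> norm y powi (k - 1) \<le> C"
        by (fastforce simp: bounded_iff)
      define f' where "f' l t = partial i (f l) (z + t *\<^sub>R axis i 1)" for l t
      have "uniformly_convergent_on (cball 0 r) (\<lambda>n t. \<Sum>l<n. f' l t)"
      proof (rule Weierstrass_m_test')
        show "summable (\<lambda>l. \<bar>B i\<bar> * C * (1/2 :: real) ^ l)"
          by (intro summable_mult summable_geometric) auto
        fix l and t :: real assume t: "t \<in> cball 0 r"
        have "norm (f' l t) \<le> B i * norm (z + t *\<^sub>R axis i 1) powi (k - 1) * (1/2) ^ l"
          unfolding f'_def real_norm_def using inV[OF t] VU[of i] by (intro B) blast
        also have "\<dots> \<le> \<bar>B i\<bar> * C * (1/2) ^ l"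
          using C[of "z + t *\<^sub>R axis i 1"] t
          by (intro mult_right_mono mult_mono) (auto simp: dist_norm)
        finally show "norm (f' l t) \<le> \<bar>B i\<bar> * C * (1/2) ^ l" .
      qed
      moreover have "((\<lambda>t. f l (z + t *\<^sub>R axis i 1)) has_real_derivative f' l t) (at t within cball 0 r)"
        if "t \<in> cball 0 r" for l t
      proof -
        have "z + t *\<^sub>R axis i 1 \<in> U" using inV[OF that] V(2) by blast
        then have "pdiff i (f l) (z + t *\<^sub>R axis i 1)" using Suc.prems by simp
        then show ?thesis
          unfolding f'_def by (rule has_field_derivative_at_within[OF pdiff_along_line])
      qed
      moreover have "summable (\<lambda>l. f l (z + 0 *\<^sub>R axis i 1))"
      proof (rule summable_comparison_test'[where N = 0])
        show "summable (\<lambda>l. A * norm z powi k * (1/2 :: real) ^ l)"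
          by (intro summable_mult summable_geometric) auto
        show "norm (f l (z + 0 *\<^sub>R axis i 1)) \<le> A * norm z powi k * (1/2) ^ l" for l
        proof -
          have "z \<in> U \<inter> ball 0 \<delta>0" using z V0 by blast
          then show ?thesis using 0(3)[of z l] by simp
        qed
      qed
      ultimately have "((\<lambda>t. \<Sum>l. f l (z + t *\<^sub>R axis i 1)) has_real_derivative (\<Sum>l. f' l 0)) (at 0)"
        using r(1)
        by (intro has_field_derivative_series'(2)[of "cball 0 r" "\<lambda>l t. f l (z + t *\<^sub>R axis i 1)" f' 0]) auto
      from partialI[OF this] show "pdiff i (\<lambda>z. \<Sum>l. f l z) z"
        "partial i (\<lambda>z. \<Sum>l. f l z) z = (\<Sum>l. partial i (f l) z)"
        by (auto simp: f'_def)
    qed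
    have "symbol_family j V (\<lambda>_. k - 1) (\<lambda>_. partial i (\<lambda>z. \<Sum>l. f l z))" for i
      using S[OF V(1) VU] by (subst symbol_family_cong[OF V(1)]) (auto simp: d)
    moreover have "symbol_family 0 V (\<lambda>_. k) (\<lambda>_ z. \<Sum>l. f l z)"
    proof (rule symbol_family_0_suminf[OF _ 0(2)])
      show "0 \<notin> V" using V(2) U(2) by blast
      show "\<bar>f l z\<bar> \<le> A * norm z powi k * (1/2) ^ l" if "z \<in> V" for l z
        using 0(3) that V0 by blast
      show "continuous_on V (f l)" for l
        using Suc.prems V(2) by (auto intro: continuous_on_subset)
    qed
    ultimately show ?thesis using d by simp
  qed
  with \<delta> show ?case by blast
qed

section \<open>Smoothness at the origin\<close>

text \<open>
  A function of order \<open>k > j\<close> is \<open>O(norm z)\<close>, which makes it continuous at 0, and even \<open>O((norm z)\<^sup>2)\<close>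
  if \<open>j > 0\<close>, which makes its partial derivatives exist and vanish at 0. They are of order
  \<open>k - 1 > j - 1\<close>, so the argument repeats.
\<close>

lemma symbol_flat:
  fixes f :: "real ^ 2 \<Rightarrow> real"
  assumes \<delta>: "\<delta> > 0"
  shows "f 0 = 0 \<Longrightarrow> symbol_family j (ball 0 \<delta> - {0}) (\<lambda>_. k) (\<lambda>_. f) \<Longrightarrow> int j < k \<Longrightarrow>
    C_on j (ball 0 \<delta>) f \<and> (j > 0 \<longrightarrow> (\<forall>i. partial i f 0 = 0))"
proof (induction j arbitrary: f k)
  have bound: "\<exists>A>0. \<forall>\<^sub>F z in nhds 0. \<bar>f z\<bar> \<le> A * norm z ^ p"
    if f0: "f 0 = 0" and gb: "geom_bounded (ball 0 \<delta> - {0}) (\<lambda>_. k) (\<lambda>_. f)" and "int p \<le> k" for f :: "real ^ 2 \<Rightarrow> real" and k p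
  proof -
    obtain A where A: "A \<ge> 1" "\<And>l z. z \<in> ball 0 \<delta> - {0} \<Longrightarrow> \<bar>f z\<bar> \<le> A ^ Suc l * norm z powi k"
      using gb by (auto elim: geom_boundedE)
    have "\<bar>f z\<bar> \<le> A * norm z ^ p" if z: "z \<in> ball 0 (min \<delta> 1)" for z
    proof (cases "z = 0")
      case False
      have "norm z powi k \<le> norm z powi int p"
        using z False \<open>int p \<le> k\<close> by (intro power_int_decreasing) auto
      then have "A * norm z powi k \<le> A * norm z ^ p"
        using A(1) by (intro mult_left_mono) auto
      then show ?thesis
        using A(2)[of z 0] z False by simp
    qed (use f0 A(1) in auto)
    then have "\<forall>\<^sub>F z in nhds 0. \<bar>f z\<bar> \<le> A * norm z ^ p"
      using \<delta> by (intro eventually_nhds_in_open[THEN eventually_mono, of "ball 0 (min \<delta> 1)"]) auto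
    with A(1) show ?thesis by (intro exI[of _ A]) auto
  qed
  have cont: "continuous_on (ball 0 \<delta>) f"
    if f: "f 0 = 0" "symbol_family 0 (ball 0 \<delta> - {0}) (\<lambda>_. k) (\<lambda>_. f)" "1 \<le> k" for f :: "real ^ 2 \<Rightarrow> real" and k
  proof -
    obtain A where A: "\<forall>\<^sub>F z in nhds 0. \<bar>f z\<bar> \<le> A * norm z ^ 1"
      using bound[of f k 1] f by auto
    have "(f \<longlongrightarrow> 0) (at 0)"
    proof (rule Lim_null_comparison)
      show "\<forall>\<^sub>F z in at 0. norm (f z) \<le> A * norm z"
        using A by (auto simp: eventually_at_filter elim: eventually_mono)
      show "((\<lambda>z::real ^ 2. A * norm z) \<longlongrightarrow> 0) (at 0)"
        by (auto intro!: tendsto_eq_intros)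
    qed
    then have "isCont f 0" using f(1) by (simp add: isCont_def)
    moreover have "isCont f z" if "z \<in> ball 0 \<delta> - {0}" for z
      using f(2) that by (auto simp: continuous_on_eq_continuous_at open_delete)
    ultimately show ?thesis
      by (metis Diff_iff continuous_at_imp_continuous_on singletonD)
  qed
  {
    case (0 f k)
    then show ?case using cont[of f k] by simp
  next
    case (Suc j f k)
    have p0: "((\<lambda>t. f (0 + t *\<^sub>R axis i 1)) has_real_derivative 0) (at 0)" for i
    proof -
      obtain A where A: "A > 0" "\<forall>\<^sub>F z in nhds 0. \<bar>f z\<bar> \<le> A * norm z ^ 2"
        using bound[of f k 2] Suc.prems by auto
      have "((\<lambda>t. t *\<^sub>R axis i 1) \<longlongrightarrow> (0 :: real ^ 2)) (at 0)"
        by (auto intro!: tendsto_eq_intros)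
      then have "\<forall>\<^sub>F t in at 0. \<bar>f (t *\<^sub>R axis i 1)\<bar> \<le> A * norm (t *\<^sub>R axis i 1 :: real ^ 2) ^ 2"
        using A(2) by (rule eventually_compose_filterlim[rotated])
      then have ev: "\<forall>\<^sub>F t in at 0. norm (f (t *\<^sub>R axis i 1) / t) \<le> A * \<bar>t\<bar>"
        unfolding eventually_at_filter
        by (rule eventually_mono) (auto simp: divide_simps power2_eq_square mult_ac)
      have "((\<lambda>t. f (t *\<^sub>R axis i 1) / t) \<longlongrightarrow> 0) (at 0)"
        by (rule Lim_null_comparison[OF ev]) (auto intro!: tendsto_eq_intros)
      then show ?thesis using Suc.prems(1) by (simp add: DERIV_def)
    qed
    have p0': "pdiff i f 0" "partial i f 0 = 0" for i
      using partialI[OF p0[of i]] by auto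
    have "C_on j (ball 0 \<delta>) (partial i f)" for i
      using Suc.IH[of "partial i f" "k - 1"] Suc.prems p0' by simp
    moreover have "pdiff i f z" if "z \<in> ball 0 \<delta>" for i z
      using Suc.prems(2) p0' that by (cases "z = 0") auto
    moreover have "continuous_on (ball 0 \<delta>) f"
      using cont[of f k] Suc.prems by simp
    ultimately show ?case using p0' by (simp only: C_on_Suc) blast
  }
qed

lemma symbol_flat_iterate:
  assumes "\<delta> > 0"
  shows "f 0 = 0 \<Longrightarrow> symbol_family (j + p) (ball 0 \<delta> - {0}) (\<lambda>_. k) (\<lambda>_. f) \<Longrightarrow> int (j + p) < k \<Longrightarrow>
    (partial i ^^ p) f 0 = 0 \<and>
    symbol_family j (ball 0 \<delta> - {0}) (\<lambda>_. k - int p) (\<lambda>_. (partial i ^^ p) f)"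
proof (induction p arbitrary: j)
  case 0
  then show ?case by simp
next
  case (Suc p)
  then have IH: "(partial i ^^ p) f 0 = 0"
    "symbol_family (Suc j) (ball 0 \<delta> - {0}) (\<lambda>_. k - int p) (\<lambda>_. (partial i ^^ p) f)"
    using Suc.IH[of "Suc j"] by auto
  have "partial i ((partial i ^^ p) f) 0 = 0"
    using symbol_flat[OF assms IH] Suc.prems by auto
  with IH(2) show ?case by (simp add: algebra_simps)
qed

lemma D_flat:
  assumes \<delta>: "\<delta> > 0" and f: "f 0 = 0" "symbol_family j (ball 0 \<delta> - {0}) (\<lambda>_. k) (\<lambda>_. f)" "int j < k"
    and \<alpha>: "fst \<alpha> + snd \<alpha> \<le> j"
  shows "D \<alpha> f 0 = 0"
proof -
  have "symbol_family (fst \<alpha> + snd \<alpha>) (ball 0 \<delta> - {0}) (\<lambda>_. k) (\<lambda>_. f)"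
    using f(2) \<alpha> by (rule symbol_family_mono)
  from symbol_flat_iterate[OF \<delta> f(1) this, of 2]
  have "(partial 2 ^^ snd \<alpha>) f 0 = 0"
    "symbol_family (fst \<alpha>) (ball 0 \<delta> - {0}) (\<lambda>_. k - int (snd \<alpha>)) (\<lambda>_. (partial 2 ^^ snd \<alpha>) f)"
    using f(3) \<alpha> by auto
  from symbol_flat_iterate[where j = 0 and p = "fst \<alpha>" and i = 1 and f = "(partial 2 ^^ snd \<alpha>) f", OF \<delta> this(1)] this(2) f(3) \<alpha>
  show ?thesis by (simp add: D_def)
qed

lemma partial_add_const: "partial i (\<lambda>z. a + f z) = partial i f"
proof -
  have "((\<lambda>t. a + f (z + t *\<^sub>R axis i 1)) has_real_derivative d) (at 0) \<longleftrightarrow>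
    ((\<lambda>t. f (z + t *\<^sub>R axis i 1)) has_real_derivative d) (at 0)" for z d
    using DERIV_add[OF DERIV_const[of a] , of "\<lambda>t. f (z + t *\<^sub>R axis i 1)" d 0]
      DERIV_add[OF DERIV_const[of "- a"] , of "\<lambda>t. a + f (z + t *\<^sub>R axis i 1)" d 0] by auto
  then show ?thesis by (simp add: partial_def deriv_def fun_eq_iff)
qed

lemma D_add_const:
  assumes "fst \<alpha> + snd \<alpha> \<ge> 1"
  shows "D \<alpha> (\<lambda>z. a + f z) = D \<alpha> f"
proof -
  have *: "(partial i ^^ Suc p) (\<lambda>z. a + f z) = (partial i ^^ Suc p) f" for i p
    by (simp only: funpow_Suc_right o_apply partial_add_const)
  show ?thesis
  proof (cases "snd \<alpha>")
    case 0
    then obtain p where "fst \<alpha> = Suc p" using assms by (cases "fst \<alpha>") auto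
    with 0 * show ?thesis by (simp only: D_def funpow_0 id_apply)
  next
    case (Suc p)
    with * show ?thesis by (simp only: D_def)
  qed
qed

lemma C_on_add_const: "C_on j U f \<Longrightarrow> C_on j U (\<lambda>z. a + f z)"
proof (cases j)
  case (Suc j')
  moreover assume "C_on j U f"
  ultimately show ?thesis
    using differentiable_add[OF differentiable_const[of a]]
    by (auto simp: partial_add_const intro: continuous_intros)
qed (auto intro: continuous_intros)

section \<open>From pointwise to locally uniform bounds\<close>

text \<open>
  The closed sets of points at which all functions are bounded by \<open>N\<close> exhaust \<open>S\<close>, so by Baire's
  theorem one of them has interior points.
\<close>

lemma pointwise_bounded_imp_bounded_on_ball:
  fixes f :: "nat \<Rightarrow> 'a::euclidean_space \<Rightarrow> real"
  assumes S: "open S" "S \<noteq> {}" and cont: "\<And>l. continuous_on S (f l)"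
    and bdd: "\<And>z. z \<in> S \<Longrightarrow> \<exists>M. \<forall>l. \<bar>f l z\<bar> \<le> M"
  obtains w r M where "r > 0" "ball w r \<subseteq> S" "\<And>l z. z \<in> ball w r \<Longrightarrow> \<bar>f l z\<bar> \<le> M"
proof -
  let ?X = "top_of_set S"
  define E where "E N = {z\<in>S. \<forall>l. \<bar>f l z\<bar> \<le> real N}" for N
  have closed: "closedin ?X (E N)" for N
  proof -
    have "E N = (\<Inter>l. {z\<in>S. \<bar>f l z\<bar> \<le> real N})" by (auto simp: E_def)
    moreover have "closedin ?X {z\<in>S. \<bar>f l z\<bar> \<le> real N}" for l
    proof -
      have "{z\<in>S. \<bar>f l z\<bar> \<le> real N} = S \<inter> f l -` {- real N..real N}" by auto
      then show ?thesis using continuous_closedin_preimage[OF cont closed_atLeastAtMost] by simp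
    qed
    ultimately show ?thesis by auto
  qed
  have "\<Union>(range E) = S"
  proof (intro equalityI subsetI)
    fix z assume z: "z \<in> S"
    then obtain M where "\<forall>l. \<bar>f l z\<bar> \<le> M" using bdd by blast
    moreover obtain N where "M \<le> real N" using real_arch_simple by blast
    ultimately have "z \<in> E N" using z by (auto simp: E_def intro: order_trans)
    then show "z \<in> \<Union>(range E)" by blast
  qed (auto simp: E_def)
  then have "?X interior_of \<Union>(range E) \<noteq> {}"
    using S(2) interior_of_topspace[of ?X] by simp
  moreover have "locally_compact_space ?X \<and> regular_space ?X"
    using S(1) locally_compact_space_open_subset[OF _ locally_compact_space_euclidean]
      regular_space_subtopology regular_space_euclidean by auto
  moreover have "?X interior_of \<Union>(range E) = {}" if "\<And>N. ?X interior_of E N = {}"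
    using \<open>locally_compact_space ?X \<and> regular_space ?X\<close> that closed
    by (intro Baire_category_alt) auto
  ultimately obtain N where "?X interior_of E N \<noteq> {}"
    by blast
  then obtain w T where wT: "openin ?X T" "w \<in> T" "T \<subseteq> E N"
    by (auto simp: interior_of_def)
  have "open T" using openin_open_trans[OF wT(1) S(1)] .
  then obtain r where "r > 0" "ball w r \<subseteq> T" using wT(2) open_contains_ball by blast
  show thesis
  proof (rule that)
    show "r > 0" by fact
    show "ball w r \<subseteq> S" using \<open>ball w r \<subseteq> T\<close> wT(3) by (auto simp: E_def)
    show "\<bar>f l z\<bar> \<le> real N" if "z \<in> ball w r" for l z
    proof -
      have "z \<in> E N" using that \<open>ball w r \<subseteq> T\<close> wT(3) by blast
      then show ?thesis by (simp add: E_def)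
    qed
  qed
qed

section \<open>Singular kernels\<close>

context elliptic_form
begin

lemma continuous_on_kernel_term:
  assumes "0 \<notin> S"
  shows "continuous_on S (kernel_term a b c m1 P l)"
proof -
  have "R a b c z \<noteq> 0" if "z \<in> S" for z
    using R_pos[of z] that assms by (metis less_irrefl)
  then show ?thesis
    unfolding kernel_term_def by (auto intro!: continuous_intros)
qed

lemma exponent_bounds:
  "nat \<bar>- 2 * (int (Suc l) + m1) + 1\<bar> \<le> (3 + 2 * nat \<bar>m1\<bar>) * Suc l"
  "3 * int (Suc l) + m2 \<le> int ((3 + nat \<bar>m2\<bar>) * Suc l)"
proof -
  have *: "\<bar>m\<bar> \<le> \<bar>m\<bar> * int (Suc l)" for m :: int
    using mult_left_mono[of 1 "int (Suc l)" "\<bar>m\<bar>"] by simp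
  have "\<bar>- 2 * (x + m) + 1\<bar> \<le> 3 * x + 2 * \<bar>m\<bar>" if "1 \<le> x" for x m :: int
    using that by (simp add: abs_if)
  from this[of "int (Suc l)" m1]
  have "\<bar>- 2 * (int (Suc l) + m1) + 1\<bar> \<le> 3 * int (Suc l) + 2 * \<bar>m1\<bar>"
    by simp
  also have "\<dots> \<le> (3 + 2 * \<bar>m1\<bar>) * int (Suc l)"
    using *[of m1] unfolding distrib_right by linarith
  also have "\<dots> = int ((3 + 2 * nat \<bar>m1\<bar>) * Suc l)"
    by (simp only: of_nat_mult of_nat_add of_nat_numeral int_nat_eq) simp
  finally show "nat \<bar>- 2 * (int (Suc l) + m1) + 1\<bar> \<le> (3 + 2 * nat \<bar>m1\<bar>) * Suc l"
    by (simp only: nat_le_iff)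
  have "3 * int (Suc l) + m2 \<le> (3 + \<bar>m2\<bar>) * int (Suc l)"
    using *[of m2] unfolding distrib_right by linarith
  also have "\<dots> = int ((3 + nat \<bar>m2\<bar>) * Suc l)"
    by (simp only: of_nat_mult of_nat_add of_nat_numeral int_nat_eq) simp
  finally show "3 * int (Suc l) + m2 \<le> int ((3 + nat \<bar>m2\<bar>) * Suc l)" .
qed

text \<open>
  The terms of a convergent series are bounded, hence uniformly bounded on some ball. The ball is
  chosen in an annulus, where \<open>R\<close> is bounded from above and below. Dividing by the power of \<open>R\<close>
  then costs only a geometric factor.
\<close>

lemma summable_kernel_imp_unit_ball_bounded:
  assumes hom: "\<And>l. l \<ge> 1 \<Longrightarrow> homogeneous2 (3 * int l + m2) (P l)"
    and \<epsilon>: "\<epsilon> > 0"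
    and sum: "\<And>z. z \<in> punctured_disk \<epsilon> \<Longrightarrow> summable (\<lambda>k. kernel_term a b c m1 P (Suc k) z)"
  shows "unit_ball_bounded (\<lambda>l. P (Suc l))"
proof -
  define S where "S = ball (0 :: real ^ 2) \<epsilon> - cball 0 (\<epsilon> / 2)"
  have S: "open S" "0 \<notin> S" "S \<subseteq> punctured_disk \<epsilon>"
    using \<epsilon> by (auto simp: S_def punctured_disk_def)
  have "(3 / 4 * \<epsilon>) *\<^sub>R axis 1 1 \<in> S" using \<epsilon> by (simp add: S_def)
  then have "S \<noteq> {}" by blast
  obtain w r M where r: "r > 0" "ball w r \<subseteq> S"
    and M: "\<And>l z. z \<in> ball w r \<Longrightarrow> \<bar>kernel_term a b c m1 P (Suc l) z\<bar> \<le> M"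
  proof (rule pointwise_bounded_imp_bounded_on_ball[OF S(1) \<open>S \<noteq> {}\<close>])
    show "continuous_on S (kernel_term a b c m1 P (Suc l))" for l
      by (rule continuous_on_kernel_term[OF S(2)])
    fix z assume "z \<in> S"
    then have "(\<lambda>k. kernel_term a b c m1 P (Suc k) z) \<longlonglongrightarrow> 0"
      using sum S(3) summable_LIMSEQ_zero by blast
    then have "Bseq (\<lambda>k. kernel_term a b c m1 P (Suc k) z)"
      using convergent_imp_Bseq convergentI by blast
    then show "\<exists>M. \<forall>l. \<bar>kernel_term a b c m1 P (Suc l) z\<bar> \<le> M"
      by (auto simp: Bseq_def)
  qed blast
  obtain A where A: "A \<ge> 1" "\<And>z. z \<noteq> 0 \<Longrightarrow> norm z \<le> A * R a b c z"
    "\<And>z. z \<noteq> 0 \<Longrightarrow> R a b c z \<le> A * norm z"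
    by (rule R_comparable) blast
  define C where "C = A * (1 + \<epsilon> + 2 / \<epsilon>)"
  have C: "C \<ge> 1" using A(1) \<epsilon> mult_mono[of 1 A 1 "1 + \<epsilon> + 2 / \<epsilon>"] by (simp add: C_def)
  define B where "B = 3 + 2 * nat \<bar>m1\<bar>"
  show ?thesis
  proof (rule unit_ball_bounded_from_ball[where w = w and r = r])
    show "homogeneous2 (3 * int (Suc l) + m2) (P (Suc l))" for l by (rule hom) simp
    show "3 * int (Suc l) + m2 \<le> int ((3 + nat \<bar>m2\<bar>) * Suc l)" for l by (rule exponent_bounds)
    show "r > 0" by fact
    have "1 \<le> C ^ B" using C by (rule one_le_power)
    then show "1 \<le> max 1 M * C ^ B" using mult_mono[of 1 "max 1 M" 1 "C ^ B"] by simp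
    fix l z assume z: "z \<in> ball w r"
    then have nz: "z \<noteq> 0" and z\<epsilon>: "norm z < \<epsilon>" "norm z > \<epsilon> / 2"
      using r(2) S(2) by (auto simp: S_def subset_iff)
    define e where "e = - 2 * (int (Suc l) + m1) + 1"
    have "R a b c z \<le> A * norm z" by (rule A(3)[OF nz])
    also have "\<dots> \<le> A * (1 + \<epsilon> + 2 / \<epsilon>)"
    proof -
      have "2 / \<epsilon> \<ge> 0" using \<epsilon> by simp
      then have "norm z \<le> 1 + \<epsilon> + 2 / \<epsilon>" using z\<epsilon> by linarith
      then show ?thesis using A(1) by (intro mult_left_mono) auto
    qed
    also have "\<dots> = C * 1" by (simp add: C_def)
    finally have RC: "R a b c z \<le> C * 1" .
    have "1 \<le> 2 / \<epsilon> * norm z" using z\<epsilon> \<epsilon> by (simp add: field_simps)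
    also have "\<dots> \<le> 2 / \<epsilon> * (A * R a b c z)" using A(2)[OF nz] \<epsilon> by (intro mult_left_mono) auto
    also have "\<dots> = A * (2 / \<epsilon>) * R a b c z" by simp
    also have "\<dots> \<le> C * R a b c z"
      using A(1) \<epsilon> R_pos[OF nz] unfolding C_def by (intro mult_right_mono mult_left_mono) auto
    finally have CR: "1 \<le> C * R a b c z" .
    have "R a b c z powi (- e) \<le> C ^ nat \<bar>- e\<bar> * 1 powi (- e)"
      using RC CR C R_pos[OF nz] by (intro power_int_comparable) auto
    also have "\<dots> \<le> (C ^ B) ^ Suc l"
      using exponent_bounds(1)[of l m1]
      by (simp only: power_int_1_left mult_1_right abs_minus_cancel)
        (intro power_le_geometric C, simp only: B_def e_def)
    finally have Rb: "R a b c z powi (- e) \<le> (C ^ B) ^ Suc l" .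
    have "eval2 (P (Suc l)) z = kernel_term a b c m1 P (Suc l) z * R a b c z powi (- e)"
      using R_pos[OF nz] unfolding kernel_term_def e_def[symmetric] by (simp add: power_int_minus)
    then have "\<bar>eval2 (P (Suc l)) z\<bar> = \<bar>kernel_term a b c m1 P (Suc l) z\<bar> * R a b c z powi (- e)"
      using R_pos[OF nz] by (simp add: abs_mult)
    also have "\<dots> \<le> max 1 M * (C ^ B) ^ Suc l"
      using M[OF z, of l] Rb R_pos[OF nz] by (intro mult_mono) auto
    also have "\<dots> \<le> max 1 M ^ Suc l * (C ^ B) ^ Suc l"
      using C power_increasing[of 1 "Suc l" "max 1 M"] by (intro mult_right_mono) auto
    also have "\<dots> = (max 1 M * C ^ B) ^ Suc l" by (simp only: power_mult_distrib)
    finally show "\<bar>eval2 (P (Suc l)) z\<bar> \<le> (max 1 M * C ^ B) ^ Suc l" .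
  qed
qed

text \<open>
  Indexed from 0, the \<open>l\<close>-th term has order
  \<open>(- 2 * (l + 1 + m1) + 1) + (3 * (l + 1) + m2) = l + (- 2 * m1 + m2 + 2)\<close>.
\<close>

lemma symbol_family_kernel:
  assumes hom: "\<And>l. l \<ge> 1 \<Longrightarrow> homogeneous2 (3 * int l + m2) (P l)"
    and bnd: "unit_ball_bounded (\<lambda>l. P (Suc l))"
  shows "symbol_family j (- {0}) (\<lambda>l. int l + (- 2 * m1 + m2 + 2)) (\<lambda>l. kernel_term a b c m1 P (Suc l))"
proof -
  have "symbol_family j (- {0}) (\<lambda>l. (- 2 * (int (Suc l) + m1) + 1) + (3 * int (Suc l) + m2))
     (\<lambda>l z. R a b c z powi (- 2 * (int (Suc l) + m1) + 1) * eval2 (P (Suc l)) z)"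
  proof (rule symbol_family_mult)
    show "symbol_family j (- {0}) (\<lambda>l. - 2 * (int (Suc l) + m1) + 1)
        (\<lambda>l z. R a b c z powi (- 2 * (int (Suc l) + m1) + 1))"
      by (rule symbol_family_R_power[OF exponent_bounds(1)])
    show "symbol_family j (- {0}) (\<lambda>l. 3 * int (Suc l) + m2) (\<lambda>l. eval2 (P (Suc l)))"
    proof (rule symbol_family_eval2[OF exponent_bounds(2)])
      show "homogeneous2 (3 * int (Suc l) + m2) (P (Suc l))" for l by (rule hom) simp
    qed (rule bnd)
  qed auto
  moreover have "(- 2 * (int (Suc l) + m1) + 1) + (3 * int (Suc l) + m2) = int l + (- 2 * m1 + m2 + 2)" for l
    by simp
  ultimately show ?thesis
    unfolding kernel_term_def by (simp only:)
qed

text \<open>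
  The first term is homogeneous of degree \<open>- 2 * m1 + m2 + 2\<close> and vanishes only at 0, hence it is
  comparable with that power of \<open>norm z\<close>. The remaining terms are of higher order and, near 0, take
  away at most half of its lower bound.
\<close>

lemma truncated_kernel_lower_bound:
  assumes hom: "\<And>l. l \<ge> 1 \<Longrightarrow> homogeneous2 (3 * int l + m2) (P l)"
    and bnd: "unit_ball_bounded (\<lambda>l. P (Suc l))"
    and m2: "m2 \<ge> - 3" and n: "n \<ge> 1"
    and nz: "\<And>z. norm z = 1 \<Longrightarrow> eval2 (P 1) z \<noteq> 0"
  obtains \<delta> A where "\<delta> > 0" "\<delta> \<le> 1" "A \<ge> 1"
    "\<And>z. z \<in> ball 0 \<delta> - {0} \<Longrightarrow>
       norm z powi (- 2 * m1 + m2 + 2) \<le> A * \<bar>truncated_kernel a b c m1 P n z\<bar>"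
proof -
  define m where "m = - 2 * m1 + m2 + 2"
  define F where "F l = kernel_term a b c m1 P (Suc l)" for l
  define U where "U = ball 0 1 - {0 :: real ^ 2}"
  have U: "open U" "U \<subseteq> cball 0 1 - {0}" by (auto simp: U_def)
  define d where "d = nat (3 + m2)"
  have d: "3 + m2 = int d" using m2 by (simp add: d_def)
  have hom1: "homogeneous2 (int d) (P 1)" using hom[of 1] d by simp
  have F0: "F 0 z = R a b c z powi (- 2 * (1 + m1) + 1) * eval2 (P 1) z" for z
    by (simp add: F_def kernel_term_def)
  obtain A where A: "A \<ge> 1" "\<And>z. z \<noteq> 0 \<Longrightarrow> norm z powi m \<le> A * \<bar>F 0 z\<bar>"
  proof (rule homogeneous_comparable[of "F 0" m])
    show "continuous_on (sphere 0 1) (F 0)"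
      unfolding F_def by (rule continuous_on_kernel_term) auto
    show "F 0 z \<noteq> 0" if "norm z = 1" for z
    proof -
      have "z \<noteq> 0" using that by auto
      then show ?thesis using R_pos[of z] nz[OF that] by (simp add: F0)
    qed
    fix t :: real and z :: "real ^ 2" assume t: "t > 0"
    have m: "m = - 2 * (1 + m1) + 1 + int d"
      using d by (simp add: m_def)
    have "F 0 (t *\<^sub>R z) = t powi (- 2 * (1 + m1) + 1) * t powi int d * F 0 z"
      unfolding F0 R_scale[OF t] eval2_scale[OF hom1] power_int_mult_distrib by simp
    also have "t powi (- 2 * (1 + m1) + 1) * t powi int d = t powi m"
      using t by (subst m, subst power_int_add) auto
    finally show "F 0 (t *\<^sub>R z) = t powi m * F 0 z" .
  qed blast
  have "symbol_family 0 U (\<lambda>l. int l + m) F"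
    unfolding F_def m_def
    by (rule symbol_family_subset[OF symbol_family_kernel[OF hom bnd]]) (auto simp: U_def)
  from symbol_family_reindex[of Suc 1, OF _ this]
  have "symbol_family 0 U (\<lambda>l. int l + (m + 1)) (\<lambda>l. F (Suc l))"
    by (simp add: algebra_simps)
  from symbol_family_finite_sum[OF U this, of "n - 1"]
  obtain B where B: "B \<ge> 1" "\<And>l z. z \<in> U \<Longrightarrow>
      \<bar>\<Sum>l<n - 1. F (Suc l) z\<bar> \<le> B ^ Suc l * norm z powi (m + 1)"
    by (auto elim: geom_boundedE)
  define \<delta> where "\<delta> = 1 / (2 * A * B)"
  have AB: "A * B \<ge> 1" using mult_mono[of 1 A 1 B] A(1) B(1) by simp
  have \<delta>: "\<delta> > 0" "\<delta> \<le> 1" using AB by (auto simp: \<delta>_def field_simps)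
  have "norm z powi m \<le> 2 * A * \<bar>truncated_kernel a b c m1 P n z\<bar>" if z: "z \<in> ball 0 \<delta> - {0}" for z
  proof -
    have z': "z \<noteq> 0" "z \<in> U" using z \<delta> by (auto simp: U_def)
    let ?T = "\<Sum>l<n - 1. F (Suc l) z"
    have "truncated_kernel a b c m1 P n z = (\<Sum>l<n. F l z)"
      unfolding truncated_kernel_def F_def by (rule sum.reindex_bij_witness[of _ Suc "\<lambda>l. l - 1"]) auto
    also have "\<dots> = F 0 z + ?T"
      using n sum.lessThan_Suc_shift[of "\<lambda>l. F l z" "n - 1"] by simp
    finally have K: "truncated_kernel a b c m1 P n z = F 0 z + ?T" .
    have "A * B * norm z \<le> 1 / 2" using z AB by (simp add: \<delta>_def field_simps)
    have "A * \<bar>?T\<bar> \<le> A * (B * norm z powi (m + 1))"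
      using B(2)[OF z'(2), of 0] A(1) by (intro mult_left_mono) auto
    also have "\<dots> = (A * B * norm z) * norm z powi m"
      using z'(1) by (simp add: power_int_add)
    also have "\<dots> \<le> 1 / 2 * norm z powi m"
      using \<open>A * B * norm z \<le> 1 / 2\<close> by (intro mult_right_mono) auto
    finally have "A * \<bar>?T\<bar> \<le> norm z powi m / 2" by simp
    moreover have "A * \<bar>F 0 z\<bar> \<le> A * \<bar>F 0 z + ?T\<bar> + A * \<bar>?T\<bar>"
      using A(1) by (subst distrib_left[symmetric], intro mult_left_mono) auto
    ultimately show ?thesis
      using A(2)[OF z'(1)] by (simp add: K)
  qed
  then show thesis
    using \<delta> A(1) by (intro that[of \<delta> "2 * A"]) (auto simp: m_def)
qed

end

theorem theorem7:
  fixes K :: "real ^ 2 \<Rightarrow> real"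
    and P :: "nat \<Rightarrow> real poly poly"
    and a b c \<epsilon> :: real
    and m1 m2 :: int
    and n :: nat
  defines "Kn \<equiv> truncated_kernel a b c m1 P n"
  defines "\<rho> \<equiv> regularized_kernel K Kn"
  assumes "m1 \<ge> 0" and "m2 \<ge> - 3" and "n \<ge> 1"
    and "a > 0" and "c > 0" and "4 * a * c - b\<^sup>2 > 0"
    and "\<epsilon> > 0"
    and "\<And>l. l \<ge> 1 \<Longrightarrow> homogeneous2 (3 * int l + m2) (P l)"
    and smooth: "C_on (n - 1) (interior (punctured_disk \<epsilon>)) K"
    and expansion: "\<And>z. z \<in> punctured_disk \<epsilon> \<Longrightarrow>
           (\<lambda>k. kernel_term a b c m1 P (Suc k) z) sums K z"
    and regularity: "zeta (kernel_monomials m1 P) = - 2 * m1 + m2 + 2"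
           "- 2 * m1 + m2 + 2 < 0"
    and nonvanishing: "\<And>z. z \<in> punctured_disk \<epsilon> \<Longrightarrow> eval2 (P 1) z \<noteq> 0"
  shows "(\<exists>\<delta>>0. \<forall>z\<in>punctured_disk \<delta>. Kn z \<noteq> 0) \<and>
         C_at (n - 1) 0 \<rho> \<and>
         (\<forall>\<alpha>. 1 \<le> fst \<alpha> + snd \<alpha> \<and> fst \<alpha> + snd \<alpha> \<le> n - 1 \<longrightarrow> D \<alpha> \<rho> 0 = 0)"
proof -
  interpret elliptic_form a b c by standard fact+
  note hom = \<open>\<And>l. l \<ge> 1 \<Longrightarrow> homogeneous2 (3 * int l + m2) (P l)\<close>
  define m where "m = - 2 * m1 + m2 + 2"
  define F where "F l = kernel_term a b c m1 P (Suc l)" for l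
  have bnd: "unit_ball_bounded (\<lambda>l. P (Suc l))"
    using summable_kernel_imp_unit_ball_bounded[OF hom \<open>\<epsilon> > 0\<close>] sums_summable[OF expansion] by blast
  have symF: "symbol_family j (- {0}) (\<lambda>l. int l + m) F" for j
    unfolding F_def m_def by (rule symbol_family_kernel[OF hom bnd])
  have P1: "eval2 (P 1) z \<noteq> 0" if "norm z = 1" for z
  proof -
    have "homogeneous2 (int (nat (3 + m2))) (P 1)" using hom[of 1] \<open>m2 \<ge> - 3\<close> by simp
    then have "eval2 (P 1) (\<epsilon> *\<^sub>R z) = \<epsilon> ^ nat (3 + m2) * eval2 (P 1) z"
      by (rule eval2_scale)
    moreover have "z \<noteq> 0" using that by auto
    then have "\<epsilon> *\<^sub>R z \<in> punctured_disk \<epsilon>"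
      using \<open>\<epsilon> > 0\<close> that by (simp add: punctured_disk_def)
    ultimately show ?thesis
      using nonvanishing[of "\<epsilon> *\<^sub>R z"] by auto
  qed
  obtain \<delta>1 A where \<delta>1: "\<delta>1 > 0" "\<delta>1 \<le> 1" and A: "A \<ge> 1"
    "\<And>z. z \<in> ball 0 \<delta>1 - {0} \<Longrightarrow> norm z powi m \<le> A * \<bar>Kn z\<bar>"
    unfolding Kn_def m_def
    using truncated_kernel_lower_bound[OF hom bnd \<open>m2 \<ge> - 3\<close> \<open>n \<ge> 1\<close> P1] by blast
  \<comment> \<open>the remainder \<open>K - Kn\<close> gains \<open>n\<close> orders on \<open>Kn\<close>\<close>
  have "symbol_family (n - 1) (- {0}) (\<lambda>l. int (l + n) + m) (\<lambda>l. F (l + n))"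
    by (rule symbol_family_reindex[OF order_refl symF])
  then have "symbol_family (n - 1) (- {0}) (\<lambda>l. int l + (int n + m)) (\<lambda>l. F (l + n))"
    by (simp add: add.assoc)
  from symbol_family_suminf[OF _ _ this]
  obtain \<delta>2 where \<delta>2: "\<delta>2 > 0" "\<And>V. open V \<Longrightarrow> V \<subseteq> (- {0}) \<inter> ball 0 \<delta>2 \<Longrightarrow>
      symbol_family (n - 1) V (\<lambda>_. int n + m) (\<lambda>_ z. \<Sum>l. F (l + n) z)"
    by auto
  define \<delta> where "\<delta> = min \<epsilon> (min \<delta>1 \<delta>2)"
  have \<delta>: "\<delta> > 0" using \<delta>1 \<delta>2 \<open>\<epsilon> > 0\<close> by (simp add: \<delta>_def)
  define V where "V = ball 0 \<delta> - {0 :: real ^ 2}"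
  have V: "open V" "0 \<notin> V" "V \<subseteq> cball 0 1 - {0}" "V \<subseteq> ball 0 \<delta>1 - {0}"
      "V \<subseteq> (- {0}) \<inter> ball 0 \<delta>2" "V \<subseteq> punctured_disk \<epsilon>"
    using \<delta>1 by (auto simp: V_def \<delta>_def punctured_disk_def)
  have Kn_nz: "Kn z \<noteq> 0" if "z \<in> V" for z
  proof -
    have "norm z powi m > 0" using that V(2) by (intro zero_less_power_int) auto
    moreover have "norm z powi m \<le> A * \<bar>Kn z\<bar>"
      using that V(4) by (intro A(2)) blast
    ultimately show ?thesis by auto
  qed
  have Kn_sum: "Kn z = (\<Sum>l<n. F l z)" for z
    unfolding Kn_def truncated_kernel_def F_def
    by (rule sum.reindex_bij_witness[of _ Suc "\<lambda>l. l - 1"]) auto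
  have "symbol_family (n - 1) V (\<lambda>l. int l + m) F"
    using symF by (rule symbol_family_subset) (use V in auto)
  from symbol_family_finite_sum[OF V(1,3) this, of n]
  have symKn: "symbol_family (n - 1) V (\<lambda>_. m) (\<lambda>_. Kn)"
    by (simp add: Kn_sum[symmetric])
  have "symbol_family (n - 1) V (\<lambda>_. - m) (\<lambda>_ z. inverse (Kn z))"
  proof (rule symbol_family_inverse[OF V(1,2) A(1) _ symKn])
    fix l :: nat and z assume z: "z \<in> V"
    have "norm z powi m \<le> A * \<bar>Kn z\<bar>" using z V(4) by (intro A(2)) blast
    also have "\<dots> = A ^ 1 * \<bar>Kn z\<bar>" by simp
    also have "\<dots> \<le> A ^ Suc l * \<bar>Kn z\<bar>"
      using A(1) by (intro mult_right_mono power_increasing) auto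
    finally show "norm z powi m \<le> A ^ Suc l * \<bar>Kn z\<bar>" .
  qed
  from symbol_family_mult[OF V(1,2) \<delta>2(2)[OF V(1,5)] this]
  have quot: "symbol_family (n - 1) V (\<lambda>_. int n) (\<lambda>_ z. (\<Sum>l. F (l + n) z) * inverse (Kn z))"
    by simp
  define f where "f z = \<rho> z - 1" for z
  have f: "f z = (\<Sum>l. F (l + n) z) * inverse (Kn z)" if z: "z \<in> V" for z
  proof -
    have "(\<lambda>l. F l z) sums K z" using expansion z V(6) by (auto simp: F_def)
    then have "K z = (\<Sum>l. F (l + n) z) + Kn z"
      using suminf_split_initial_segment[of "\<lambda>l. F l z" n]
      by (simp add: sums_iff Kn_sum)
    then show ?thesis
      using z V(2) Kn_nz[OF z] by (auto simp: f_def \<rho>_def regularized_kernel_def field_simps)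
  qed
  have f0: "f 0 = 0" by (simp add: f_def \<rho>_def regularized_kernel_def)
  have symf: "symbol_family (n - 1) (ball 0 \<delta> - {0}) (\<lambda>_. int n) (\<lambda>_. f)"
    unfolding V_def[symmetric] using quot by (subst symbol_family_cong[OF V(1)]) (auto simp: f)
  have less: "int (n - 1) < int n" using \<open>n \<ge> 1\<close> by simp
  have \<rho>: "\<rho> = (\<lambda>z. 1 + f z)" by (simp add: f_def)
  have "\<forall>z\<in>punctured_disk (\<delta> / 2). Kn z \<noteq> 0"
    using Kn_nz \<delta> by (auto simp: punctured_disk_def V_def)
  moreover have "C_at (n - 1) 0 \<rho>"
    unfolding C_at_def \<rho> using symbol_flat[OF \<delta> f0 symf less] \<delta>
    by (intro exI[of _ "ball 0 \<delta>"]) (auto intro: C_on_add_const)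
  moreover have "D \<alpha> \<rho> 0 = 0" if "1 \<le> fst \<alpha> + snd \<alpha>" "fst \<alpha> + snd \<alpha> \<le> n - 1" for \<alpha>
    unfolding \<rho> D_add_const[OF that(1)] using D_flat[OF \<delta> f0 symf less that(2)] .
  ultimately show ?thesis using \<delta> half_gt_zero by blast
qed

end
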